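(* Let $P$ be a graded poset equipped with a family of Pieri operators $\{\overline{h}_k\}_{k>0}$, and let $K\colon \mathcal{H}P\to \mathcal{Q}\mathit{sym}$ be the associated $\mathbb{Z}$-linear map sending (a product of) intervals to quasi-symmetric functions. Then $K$ is a morphism of Hopf algebras.
   Context: $NC=\mathbb{Z}\langle h_1,h_2,\ldots\rangle$ is the Hopf algebra of noncommutative symmetric functions: the free associative algebra with one generator $h_k$ in each degree $k\ge 1$ and coproduct $\Delta h_k=\sum_{i=0}^k h_i\otimes h_{k-i}$, $h_0=1$. For a composition $\alpha=(\alpha_1,\dots,\alpha_\ell)$ put $S^\alpha=h_{\alpha_1}\cdots h_{\alpha_\ell}$. $\mathcal{Q}\mathit{sym}$ is the Hopf algebra of quasi-symmetric functions over $\mathbb{Z}$, with monomial basis $M_\alpha=\sum_{i_1<\cdots<i_\ell} z_{i_1}^{\alpha_1}\cdots z_{i_\ell}^{\alpha_\ell}$; it is the graded Hopf dual of $NC$, with $\{M_\alpha\}$ dual to $\{S^\alpha\}$, so quasi-symmetric functions are regarded as linear functionals on $NC$. $(P,<)$ is a graded poset with rank function $rk$ taking nonnegative integer values, with all intervals finite. $\mathbb{Z}P$ is the free $\mathbb{Z}$-module on $P$, and $\langle\cdot,\cdot\rangle$ is the bilinear form for which the elements of $P$ are orthonormal (similarly on $\mathbb{Z}P^{\otimes k}=\mathbb{Z}(P^k)$). A (right) Pieri operator $\overline{h}_k$ ($k>0$) is a linear map $\mathbb{Z}P\to\mathbb{Z}P$, $x\mapsto x.\overline{h}_k$, such that for all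 $x\in P$ the support of $x.\overline{h}_k$ consists only of elements $y$ with $x<y$ and $rk(y)-rk(x)=k$. A family $\{\overline{h}_k\}_{k>0}$ makes $\mathbb{Z}P$ a right $NC$-module via $h_k\mapsto\overline{h}_k$. Using the iterated coproduct of $NC$, $\mathbb{Z}(P^k)=(\mathbb{Z}P)^{\otimes k}$ is also a right $NC$-module for each $k$. $\mathcal{H}P$ is the free $\mathbb{Z}$-module with basis the (ordered, finite) Cartesian products of intervals $[x,y]$ of $P$, modulo identifying all singleton intervals $[x,x]$ with the unit $1$ and empty intervals with $0$. Its product is Cartesian product of intervals, its grading is by the rank of an interval, its coproduct is induced by $\Delta A=\sum_{x\in A}[\hat 0_A,x]\otimes[x,\hat 1_A]$ for an interval $A=[\hat 0_A,\hat 1_A]$ (of $P$ or of a power $P^k$), and its counit is projection onto the degree $0$ component $\mathbb{Z}$. It is a graded bialgebra with degree-$0$ part $\mathbb{Z}$, hence a Hopf algebra. For $A=[\hat 0_A,\hat 1_A]$ an interval of $P^k$ (a product of $k$ intervals of $P$), $K_A\in\mathcal{Q}\mathit{sym}$ is the functional $K_A(\Psi)=\langle \hat 0_A.\Psi,\hat 1_A\rangle$, $\Psi\in NC$. This extends linearly to $K\colon\mathcal{H}P\to\mathcal{Q}\mathit{sym}$. *)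

theory Defs
  imports
    Complex_Main
    "HOL-Library.Poly_Mapping"
    "HOL-Library.Product_Plus"
begin

text \<open>
  \<open>'a \<Rightarrow>\<^sub>0 int\<close> is the free \<open>\<int>\<close>-module on \<open>'a\<close>; if \<open>'a\<close> is a (not necessarily commutative)
  monoid, written additively, it is the monoid ring.  A \<open>\<int>\<close>-linear map is an \<open>additive\<close> one.
\<close>


section \<open>Tensor products over the integers\<close>

inductive_set tensor_rel :: "('a::ab_group_add \<times> 'b::ab_group_add \<Rightarrow>\<^sub>0 int) set" where
  zero: "0 \<in> tensor_rel"
| diff: "u \<in> tensor_rel \<Longrightarrow> v \<in> tensor_rel \<Longrightarrow> u - v \<in> tensor_rel"
| left: "frag_of (a + a', b) - frag_of (a, b) - frag_of (a', b) \<in> tensor_rel"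
| right: "frag_of (a, b + b') - frag_of (a, b) - frag_of (a, b') \<in> tensor_rel"

lemma tensor_rel_minus: "u \<in> tensor_rel \<Longrightarrow> - u \<in> tensor_rel"
  using tensor_rel.diff[OF tensor_rel.zero] by simp

lemma tensor_rel_add: "u \<in> tensor_rel \<Longrightarrow> v \<in> tensor_rel \<Longrightarrow> u + v \<in> tensor_rel"
  using tensor_rel.diff[OF _ tensor_rel_minus] by fastforce

quotient_type (overloaded) ('a, 'b) tensor =
    "'a::ab_group_add \<times> 'b::ab_group_add \<Rightarrow>\<^sub>0 int" / "\<lambda>u v. u - v \<in> tensor_rel"
proof (rule equivpI)
  show "reflp (\<lambda>u v :: 'a \<times> 'b \<Rightarrow>\<^sub>0 int. u - v \<in> tensor_rel)"
    by (simp add: reflp_def tensor_rel.zero)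
  show "symp (\<lambda>u v :: 'a \<times> 'b \<Rightarrow>\<^sub>0 int. u - v \<in> tensor_rel)"
    by (auto intro!: sympI dest: tensor_rel_minus)
  show "transp (\<lambda>u v :: 'a \<times> 'b \<Rightarrow>\<^sub>0 int. u - v \<in> tensor_rel)"
    by (auto intro!: transpI dest: tensor_rel_add)
qed

instantiation tensor :: (ab_group_add, ab_group_add) ab_group_add
begin

lift_definition zero_tensor :: "('a, 'b) tensor" is 0 .

lift_definition plus_tensor :: "('a, 'b) tensor \<Rightarrow> ('a, 'b) tensor \<Rightarrow> ('a, 'b) tensor" is "(+)"
  by (auto dest: tensor_rel_add simp: algebra_simps)

lift_definition uminus_tensor :: "('a, 'b) tensor \<Rightarrow> ('a, 'b) tensor" is uminus
  by (auto dest: tensor_rel_minus simp: algebra_simps)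

lift_definition minus_tensor :: "('a, 'b) tensor \<Rightarrow> ('a, 'b) tensor \<Rightarrow> ('a, 'b) tensor" is minus
  by (drule (1) tensor_rel.diff) (simp add: algebra_simps)

instance
  by standard (transfer; simp add: algebra_simps tensor_rel.zero)+

end

lift_definition tensor_of :: "'a::ab_group_add \<Rightarrow> 'b::ab_group_add \<Rightarrow> ('a, 'b) tensor"
    (infixl \<open>\<otimes>\<^sub>t\<close> 75)
  is "\<lambda>a b. frag_of (a, b)" .

lemma tensor_of_add_left: "(a + a') \<otimes>\<^sub>t b = a \<otimes>\<^sub>t b + a' \<otimes>\<^sub>t b"
  by transfer (metis diff_diff_add tensor_rel.left)

lemma tensor_of_add_right: "a \<otimes>\<^sub>t (b + b') = a \<otimes>\<^sub>t b + a \<otimes>\<^sub>t b'"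
  by transfer (metis diff_diff_add tensor_rel.right)

text \<open>
  The linear map on \<open>A \<otimes> B\<close> given by a bilinear map on \<open>A \<times> B\<close>; see \<open>tensor_lift_of\<close> below.
\<close>

definition tensor_lift ::
    "('a::ab_group_add \<Rightarrow> 'b::ab_group_add \<Rightarrow> 'c::ab_group_add) \<Rightarrow> ('a, 'b) tensor \<Rightarrow> 'c" where
  "tensor_lift f = (THE \<phi>. additive \<phi> \<and> (\<forall>a b. \<phi> (a \<otimes>\<^sub>t b) = f a b))"

definition tensor_map ::
    "('a::ab_group_add \<Rightarrow> 'c::ab_group_add) \<Rightarrow> ('b::ab_group_add \<Rightarrow> 'd::ab_group_add) \<Rightarrow>
      ('a, 'b) tensor \<Rightarrow> ('c, 'd) tensor" where
  "tensor_map f g = tensor_lift (\<lambda>a b. f a \<otimes>\<^sub>t g b)"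


subsection \<open>The universal property\<close>

definition int_scale :: "int \<Rightarrow> 'a::ab_group_add \<Rightarrow> 'a" where
  "int_scale n x = (\<Sum>i<nat n. x) - (\<Sum>i<nat (- n). x)"

lemma int_scale_0 [simp]: "int_scale 0 x = 0"
  and int_scale_1 [simp]: "int_scale 1 x = x"
  by (simp_all add: int_scale_def)

lemma int_scale_of_nat_diff:
  "int_scale (int m - int n) x = (\<Sum>i<m. x) - (\<Sum>i<n. x)"
proof (cases "n \<le> m")
  case True
  then obtain k where "m = n + k" using le_Suc_ex by blast
  moreover have "(\<Sum>i<n + k. x) = (\<Sum>i<n. x) + (\<Sum>i<k. x)" by (induction k) (simp_all add: algebra_simps)
  ultimately show ?thesis by (simp add: int_scale_def)
next
  case False
  then obtain k where "n = m + k" using nat_le_linear le_Suc_ex by blast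
  moreover have "(\<Sum>i<m + k. x) = (\<Sum>i<m. x) + (\<Sum>i<k. x)" by (induction k) (simp_all add: algebra_simps)
  ultimately show ?thesis by (simp add: int_scale_def)
qed

lemma int_scale_diff: "int_scale (m - n) x = int_scale m x - int_scale n x"
proof -
  have add: "(\<Sum>i<p + q. x) = (\<Sum>i<p. x) + (\<Sum>i<q. x)" for p q :: nat
    by (induction q) (simp_all add: algebra_simps)
  obtain a b where m: "m = int a - int b" using int_diff_cases by blast
  obtain c d where n: "n = int c - int d" using int_diff_cases by blast
  have "m - n = int (a + d) - int (b + c)" by (simp add: m n)
  then have "int_scale (m - n) x = (\<Sum>i<a + d. x) - (\<Sum>i<b + c. x)"
    by (simp only: int_scale_of_nat_diff)
  then show ?thesis by (simp only: m n int_scale_of_nat_diff add) (simp add: algebra_simps)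
qed

lemma additive_diff: "additive f \<Longrightarrow> f (a - b) = f a - f b"
  by (rule additive.diff)

lemma additive_0: "additive f \<Longrightarrow> f 0 = 0"
  by (rule additive.zero)

definition free_lift :: "('x \<Rightarrow> 'c::ab_group_add) \<Rightarrow> ('x \<Rightarrow>\<^sub>0 int) \<Rightarrow> 'c" where
  "free_lift f u = (\<Sum>x \<in> Poly_Mapping.keys u. int_scale (Poly_Mapping.lookup u x) (f x))"

lemma free_lift_superset:
  assumes "finite S" "Poly_Mapping.keys u \<subseteq> S"
  shows "free_lift f u = (\<Sum>x \<in> S. int_scale (Poly_Mapping.lookup u x) (f x))"
  unfolding free_lift_def
  by (rule sum.mono_neutral_left) (use assms in \<open>auto simp: in_keys_iff\<close>)

lemma free_lift_frag_of [simp]: "free_lift f (frag_of x) = f x"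
  by (simp add: free_lift_def)

lemma free_lift_0 [simp]: "free_lift f 0 = 0"
  by (simp add: free_lift_def)

lemma free_lift_diff: "free_lift f (u - v) = free_lift f u - free_lift f v"
proof -
  let ?S = "Poly_Mapping.keys u \<union> Poly_Mapping.keys v"
  have "free_lift f w = (\<Sum>x \<in> ?S. int_scale (Poly_Mapping.lookup w x) (f x))"
    if "Poly_Mapping.keys w \<subseteq> ?S" for w
    by (rule free_lift_superset) (use that in auto)
  from this[of u] this[of v] this[of "u - v"] keys_diff[of u v] show ?thesis
    by (simp add: lookup_minus int_scale_diff sum_subtractf)
qed

lemma free_lift_add: "free_lift f (u + v) = free_lift f u + free_lift f v"
  using free_lift_diff[of f u "0 - v"] free_lift_diff[of f 0 v] by simp

lemma additive_free_ext:
  assumes "additive \<phi>" "additive \<psi>" "\<And>x. \<phi> (frag_of x) = \<psi> (frag_of x)"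
  shows "\<phi> u = \<psi> u"
  using subset_UNIV
  by (induction u rule: frag_induction)
     (simp_all add: assms additive_0 additive_diff)

lemma tensor_lift_unique:
  fixes f :: "'a::ab_group_add \<Rightarrow> 'b::ab_group_add \<Rightarrow> 'c::ab_group_add"
  assumes "\<And>b. additive (\<lambda>a. f a b)" "\<And>a. additive (f a)"
  shows "\<exists>!\<phi>. additive \<phi> \<and> (\<forall>a b. \<phi> (a \<otimes>\<^sub>t b) = f a b)"
proof -
  let ?F = "free_lift (\<lambda>(a, b). f a b)"
  have rel: "?F u = 0" if "u \<in> tensor_rel" for u
    using that
    by (induction rule: tensor_rel.induct)
       (simp_all add: free_lift_diff additive.add[OF assms(1)] additive.add[OF assms(2)])
  define \<phi> where "\<phi> t = ?F (rep_tensor t)" for t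
  have abs: "\<phi> (abs_tensor u) = ?F u" for u
  proof -
    have "rep_tensor (abs_tensor u) - u \<in> tensor_rel"
      using Quotient3_tensor rep_abs_rsp_left[OF Quotient3_tensor, of u u] by (simp add: tensor_rel.zero)
    then show ?thesis using rel free_lift_diff[of "\<lambda>(a, b). f a b"] unfolding \<phi>_def by fastforce
  qed
  show ?thesis
  proof (rule ex1I[of _ \<phi>], intro conjI allI)
    have "\<phi> (s + t) = \<phi> s + \<phi> t" for s t
      by (induction s, induction t) (simp add: plus_tensor.abs_eq abs free_lift_add)
    then show "additive \<phi>" by unfold_locales
    show "\<phi> (a \<otimes>\<^sub>t b) = f a b" for a b by (simp add: tensor_of.abs_eq abs)
  next
    fix \<psi> assume \<psi>: "additive \<psi> \<and> (\<forall>a b. \<psi> (a \<otimes>\<^sub>t b) = f a b)"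
    show "\<psi> = \<phi>"
    proof
      fix t
      obtain u :: "'a \<times> 'b \<Rightarrow>\<^sub>0 int" where t: "t = abs_tensor u" by (induction t) auto
      have "\<psi> (abs_tensor u) = ?F u"
      proof (rule additive_free_ext)
        show "additive (\<lambda>u. \<psi> (abs_tensor u))"
          by unfold_locales (metis \<psi> additive.add plus_tensor.abs_eq)
        show "additive ?F" by unfold_locales (rule free_lift_add)
        show "\<psi> (abs_tensor (frag_of x)) = ?F (frag_of x)" for x
          using \<psi> by (cases x) (simp flip: tensor_of.abs_eq)
      qed
      then show "\<psi> t = \<phi> t" by (simp add: t abs)
    qed
  qed
qed

lemma
  assumes "\<And>b. additive (\<lambda>a. f a b)" "\<And>a. additive (f a)"
  shows additive_tensor_lift: "additive (tensor_lift f)"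
    and tensor_lift_of: "tensor_lift f (a \<otimes>\<^sub>t b) = f a b"
  using theI'[OF tensor_lift_unique[OF assms]] unfolding tensor_lift_def by blast+


section \<open>Morphisms of Hopf algebras over the integers\<close>

definition is_antipode ::
    "('a::ring_1 \<Rightarrow> ('a, 'a) tensor) \<Rightarrow> ('a \<Rightarrow> int) \<Rightarrow> ('a \<Rightarrow> 'a) \<Rightarrow> bool" where
  "is_antipode \<Delta> \<epsilon> S \<longleftrightarrow>
     additive S \<and>
     (\<forall>a. tensor_lift (\<lambda>x y. S x * y) (\<Delta> a) = of_int (\<epsilon> a)) \<and>
     (\<forall>a. tensor_lift (\<lambda>x y. x * S y) (\<Delta> a) = of_int (\<epsilon> a))"

text \<open>
  For a coassociative and counital \<open>\<Delta>\<close>, the antipode is unique if it exists, being the convolution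
  inverse of the identity.
\<close>

definition hopf_morphism ::
    "('a::ring_1 \<Rightarrow> ('a, 'a) tensor) \<Rightarrow> ('a \<Rightarrow> int) \<Rightarrow>
     ('b::ring_1 \<Rightarrow> ('b, 'b) tensor) \<Rightarrow> ('b \<Rightarrow> int) \<Rightarrow> ('a \<Rightarrow> 'b) \<Rightarrow> bool" where
  "hopf_morphism \<Delta>\<^sub>A \<epsilon>\<^sub>A \<Delta>\<^sub>B \<epsilon>\<^sub>B f \<longleftrightarrow>
     additive f \<and>
     f 1 = 1 \<and> (\<forall>a b. f (a * b) = f a * f b) \<and>
     (\<forall>a. \<epsilon>\<^sub>B (f a) = \<epsilon>\<^sub>A a) \<and> (\<forall>a. \<Delta>\<^sub>B (f a) = tensor_map f f (\<Delta>\<^sub>A a)) \<and>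
     (\<exists>S\<^sub>A S\<^sub>B. is_antipode \<Delta>\<^sub>A \<epsilon>\<^sub>A S\<^sub>A \<and> is_antipode \<Delta>\<^sub>B \<epsilon>\<^sub>B S\<^sub>B \<and> (\<forall>a. f (S\<^sub>A a) = S\<^sub>B (f a)))"


section \<open>Noncommutative symmetric functions\<close>

typedef composition = "{\<alpha> :: nat list. 0 \<notin> set \<alpha>}"
  morphisms parts composition
  by (rule exI[of _ "[]"]) simp

setup_lifting type_definition_composition

instantiation composition :: monoid_add
begin

lift_definition zero_composition :: composition is "[]" by simp

lift_definition plus_composition :: "composition \<Rightarrow> composition \<Rightarrow> composition" is "(@)" by simp

instance by standard (transfer; simp)+

end

text \<open>
  \<open>frag_of \<alpha>\<close> is \<open>S\<^sup>\<alpha> = h\<^bsub>\<alpha>\<^sub>1\<^esub> \<cdots> h\<^bsub>\<alpha>\<^sub>l\<^esub>\<close>, since addition of compositions is concatenation.  As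
  \<open>NC\<close> is free on the \<open>S\<^sup>\<alpha>\<close>, its tensor square is taken as the monoid ring of pairs of compositions.
\<close>

type_synonym nc = "composition \<Rightarrow>\<^sub>0 int"

definition h_index :: "nat \<Rightarrow> composition" where
  "h_index k = (if k = 0 then 0 else composition [k])"

definition nc_coprod_gen :: "nat \<Rightarrow> (composition \<times> composition \<Rightarrow>\<^sub>0 int)" where
  "nc_coprod_gen k = (\<Sum>i\<le>k. frag_of (h_index i, h_index (k - i)))"

definition nc_coprod :: "nc \<Rightarrow> (composition \<times> composition \<Rightarrow>\<^sub>0 int)" where
  "nc_coprod = frag_extend (\<lambda>\<alpha>. prod_list (map nc_coprod_gen (parts \<alpha>)))"

definition nc_counit :: "nc \<Rightarrow> int" where
  "nc_counit \<Psi> = Poly_Mapping.lookup \<Psi> 0"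


section \<open>Quasi-symmetric functions\<close>

text \<open>
  Formal power series in \<open>z\<^sub>0, z\<^sub>1, \<dots>\<close> are represented by their coefficients, as functions of
  the exponent vectors \<open>m :: nat \<Rightarrow>\<^sub>0 nat\<close>.
\<close>

definition exponents :: "(nat \<Rightarrow>\<^sub>0 nat) \<Rightarrow> nat list" where
  "exponents m = map (Poly_Mapping.lookup m) (sorted_list_of_set (Poly_Mapping.keys m))"

definition quasi_symmetric :: "((nat \<Rightarrow>\<^sub>0 nat) \<Rightarrow> int) \<Rightarrow> bool" where
  "quasi_symmetric f \<longleftrightarrow> (\<forall>m m'. exponents m = exponents m' \<longrightarrow> f m = f m')"

definition bounded_degree :: "((nat \<Rightarrow>\<^sub>0 nat) \<Rightarrow> int) \<Rightarrow> bool" where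
  "bounded_degree f \<longleftrightarrow> (\<exists>d. \<forall>m. f m \<noteq> 0 \<longrightarrow> sum_list (exponents m) \<le> d)"

typedef qsym = "{f. quasi_symmetric f \<and> bounded_degree f}"
  morphisms mcoeff Abs_qsym
  by (rule exI[of _ "\<lambda>_. 0"]) (simp add: quasi_symmetric_def bounded_degree_def)

setup_lifting type_definition_qsym


subsection \<open>The ring structure\<close>

definition decomps :: "(nat \<Rightarrow>\<^sub>0 nat) \<Rightarrow> ((nat \<Rightarrow>\<^sub>0 nat) \<times> (nat \<Rightarrow>\<^sub>0 nat)) set" where
  "decomps m = {(a, b). a + b = m}"

definition ps_mult ::
    "((nat \<Rightarrow>\<^sub>0 nat) \<Rightarrow> int) \<Rightarrow> ((nat \<Rightarrow>\<^sub>0 nat) \<Rightarrow> int) \<Rightarrow> (nat \<Rightarrow>\<^sub>0 nat) \<Rightarrow> int" where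
  "ps_mult f g m = (\<Sum>(a, b) \<in> decomps m. f a * g b)"

definition list_decomps :: "nat list \<Rightarrow> (nat list \<times> nat list) set" where
  "list_decomps l = {(as, bs). length as = length l \<and> length bs = length l \<and>
      (\<forall>i<length l. as ! i + bs ! i = l ! i)}"

lemma exponents_eq_filter:
  assumes "Poly_Mapping.keys a \<subseteq> Poly_Mapping.keys m"
  shows "exponents a =
    filter (\<lambda>e. e \<noteq> 0) (map (Poly_Mapping.lookup a) (sorted_list_of_set (Poly_Mapping.keys m)))"
proof -
  have "sorted_list_of_set (Poly_Mapping.keys a) =
      filter (\<lambda>i. Poly_Mapping.lookup a i \<noteq> 0) (sorted_list_of_set (Poly_Mapping.keys m))"
    by (rule sorted_distinct_set_unique)
       (use assms in \<open>auto simp: in_keys_iff intro: sorted_wrt_filter\<close>)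
  then show ?thesis by (simp add: exponents_def filter_map o_def)
qed

lemma bij_betw_decomps:
  "bij_betw (\<lambda>(a, b). (map (Poly_Mapping.lookup a) (sorted_list_of_set (Poly_Mapping.keys m)),
                       map (Poly_Mapping.lookup b) (sorted_list_of_set (Poly_Mapping.keys m))))
     (decomps m) (list_decomps (exponents m))"
proof -
  define ks where "ks = sorted_list_of_set (Poly_Mapping.keys m)"
  have ks: "set ks = Poly_Mapping.keys m" "distinct ks" by (simp_all add: ks_def)
  have ex: "exponents m = map (Poly_Mapping.lookup m) ks" by (simp add: exponents_def ks_def)
  let ?P = "\<lambda>as. Poly_Mapping.the_value (zip ks as)"
  have lookP: "Poly_Mapping.lookup (?P as) k = (case map_of (zip ks as) k of None \<Rightarrow> 0 | Some v \<Rightarrow> v)"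
    for as :: "nat list" and k by (simp add: the_value.rep_eq)
  have lookP_in: "Poly_Mapping.lookup (?P as) (ks ! i) = as ! i"
    if "length as = length ks" "i < length ks" for as :: "nat list" and i
    using that ks by (simp add: lookP map_of_zip_nth)
  have lookP_out: "Poly_Mapping.lookup (?P as) k = 0"
    if "length as = length ks" "k \<notin> set ks" for as :: "nat list" and k
  proof -
    have "map_of (zip ks as) k = None" using that by (auto simp: map_of_eq_None_iff dest: set_zip_leftD)
    then show ?thesis by (simp add: lookP)
  qed
  have mapP: "map (Poly_Mapping.lookup (?P as)) ks = as" if "length as = length ks" for as :: "nat list"
    using that by (intro nth_equalityI) (simp_all add: lookP_in)
  have Pmap: "?P (map (Poly_Mapping.lookup a) ks) = a" if "Poly_Mapping.keys a \<subseteq> set ks" for a :: "nat \<Rightarrow>\<^sub>0 nat"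
  proof (rule poly_mapping_eqI)
    fix k
    show "Poly_Mapping.lookup (?P (map (Poly_Mapping.lookup a) ks)) k = Poly_Mapping.lookup a k"
    proof (cases "k \<in> set ks")
      case True
      then obtain i where "i < length ks" "k = ks ! i" by (auto simp: in_set_conv_nth)
      then show ?thesis by (simp add: lookP_in)
    next
      case False
      then have "k \<notin> Poly_Mapping.keys a" using that by blast
      then show ?thesis using False by (simp add: lookP_out in_keys_iff)
    qed
  qed
  have sub: "Poly_Mapping.keys a \<subseteq> set ks" "Poly_Mapping.keys b \<subseteq> set ks" if "(a, b) \<in> decomps m" for a b
    using that unfolding ks by (auto simp: decomps_def in_keys_iff lookup_add)
  have "bij_betw (\<lambda>(a, b). (map (Poly_Mapping.lookup a) ks, map (Poly_Mapping.lookup b) ks))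
     (decomps m) (list_decomps (exponents m))"
  proof (rule bij_betw_byWitness[where f' = "\<lambda>(as, bs). (?P as, ?P bs)"])
    show "(\<lambda>(a, b). (map (Poly_Mapping.lookup a) ks, map (Poly_Mapping.lookup b) ks))
        ` decomps m \<subseteq> list_decomps (exponents m)"
      by (auto simp: decomps_def list_decomps_def ex lookup_add)
    show "(\<lambda>(as, bs). (?P as, ?P bs)) ` list_decomps (exponents m) \<subseteq> decomps m"
    proof (clarsimp simp: decomps_def list_decomps_def ex)
      fix as bs :: "nat list"
      assume len: "length as = length ks" "length bs = length ks"
        and sum: "\<forall>i<length ks. as ! i + bs ! i = Poly_Mapping.lookup m (ks ! i)"
      show "?P as + ?P bs = m"
      proof (rule poly_mapping_eqI)
        fix k
        show "Poly_Mapping.lookup (?P as + ?P bs) k = Poly_Mapping.lookup m k"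
        proof (cases "k \<in> set ks")
          case True
          then obtain i where "i < length ks" "k = ks ! i" by (auto simp: in_set_conv_nth)
          then show ?thesis using sum len by (simp add: lookP_in lookup_add)
        next
          case False
          then show ?thesis using len ks by (simp add: lookP_out lookup_add in_keys_iff)
        qed
      qed
    qed
  qed (auto simp: Pmap sub mapP list_decomps_def ex)
  then show ?thesis by (simp add: ks_def)
qed

lemma finite_list_decomps: "finite (list_decomps l)"
proof -
  let ?L = "{as. set as \<subseteq> {..sum_list l} \<and> length as = length l}"
  have "list_decomps l \<subseteq> ?L \<times> ?L"
  proof (clarsimp simp: list_decomps_def, intro conjI subsetI)
    fix as bs :: "nat list" and x
    assume *: "length as = length l" "length bs = length l"
      "\<forall>i<length l. as ! i + bs ! i = l ! i"
    have le: "l ! i \<le> sum_list l" if "i < length l" for i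
      using that by (simp add: elem_le_sum_list)
    have "as ! i \<le> sum_list l \<and> bs ! i \<le> sum_list l" if "i < length l" for i
      using *(3) le[OF that] that by fastforce
    then show "x \<in> set as \<Longrightarrow> x \<in> {..sum_list l}" "x \<in> set bs \<Longrightarrow> x \<in> {..sum_list l}"
      using *(1,2) by (auto simp: in_set_conv_nth)
  qed
  then show ?thesis
    by (rule finite_subset) (intro finite_cartesian_product finite_lists_length_eq; simp)
qed

lemma finite_decomps: "finite (decomps m)"
  using bij_betw_finite[OF bij_betw_decomps] finite_list_decomps by blast

lemma sum_list_exponents: "sum_list (exponents m) = (\<Sum>k \<in> Poly_Mapping.keys m. Poly_Mapping.lookup m k)"
  by (simp add: exponents_def sum_list_distinct_conv_sum_set)

lemma sum_list_exponents_add: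
  "sum_list (exponents (a + b)) = sum_list (exponents a) + sum_list (exponents b)"
proof -
  have *: "sum_list (exponents m) = (\<Sum>k \<in> Poly_Mapping.keys a \<union> Poly_Mapping.keys b. Poly_Mapping.lookup m k)"
    if "Poly_Mapping.keys m \<subseteq> Poly_Mapping.keys a \<union> Poly_Mapping.keys b" for m
    unfolding sum_list_exponents
    by (rule sum.mono_neutral_left) (use that in \<open>auto simp: in_keys_iff\<close>)
  show ?thesis
    using *[of a] *[of b] *[of "a + b"] keys_add[of a b] by (simp add: lookup_add sum.distrib)
qed

lemma quasi_symmetric_ps_mult:
  assumes f: "quasi_symmetric f" and g: "quasi_symmetric g"
  shows "quasi_symmetric (ps_mult f g)"
proof -
  define F where "F l = f (SOME m. exponents m = l)" for l
  define G where "G l = g (SOME m. exponents m = l)" for l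
  have F: "f m = F (exponents m)" and G: "g m = G (exponents m)" for m
    using f g someI[of "\<lambda>m'. exponents m' = exponents m", OF refl]
    unfolding F_def G_def quasi_symmetric_def by metis+
  have "ps_mult f g m =
      (\<Sum>(as, bs) \<in> list_decomps (exponents m). F (filter (\<lambda>e. e \<noteq> 0) as) * G (filter (\<lambda>e. e \<noteq> 0) bs))"
    for m
    unfolding ps_mult_def sum.reindex_bij_betw[OF bij_betw_decomps, symmetric]
  proof (rule sum.cong[OF refl], clarify)
    fix a b assume "(a, b) \<in> decomps m"
    then have "Poly_Mapping.keys a \<subseteq> Poly_Mapping.keys m" "Poly_Mapping.keys b \<subseteq> Poly_Mapping.keys m"
      by (auto simp: decomps_def in_keys_iff lookup_add)
    then show "f a * g b =
       F (filter (\<lambda>e. e \<noteq> 0) (map (Poly_Mapping.lookup a) (sorted_list_of_set (Poly_Mapping.keys m)))) *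
       G (filter (\<lambda>e. e \<noteq> 0) (map (Poly_Mapping.lookup b) (sorted_list_of_set (Poly_Mapping.keys m))))"
      using F[of a] G[of b] exponents_eq_filter by metis
  qed
  then show ?thesis by (simp add: quasi_symmetric_def)
qed

lemma bounded_degree_ps_mult:
  assumes "bounded_degree f" "bounded_degree g"
  shows "bounded_degree (ps_mult f g)"
proof -
  obtain d e where d: "\<And>m. f m \<noteq> 0 \<Longrightarrow> sum_list (exponents m) \<le> d"
    and e: "\<And>m. g m \<noteq> 0 \<Longrightarrow> sum_list (exponents m) \<le> e"
    using assms unfolding bounded_degree_def by metis
  have "sum_list (exponents m) \<le> d + e" if "ps_mult f g m \<noteq> 0" for m
  proof -
    obtain p where "p \<in> decomps m" "(case p of (a, b) \<Rightarrow> f a * g b) \<noteq> 0"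
      using \<open>ps_mult f g m \<noteq> 0\<close> unfolding ps_mult_def by (rule sum.not_neutral_contains_not_neutral)
    then obtain a b where "m = a + b" "f a \<noteq> 0" "g b \<noteq> 0"
      by (auto simp: decomps_def split: prod.splits)
    then show ?thesis using d e by (simp add: sum_list_exponents_add add_mono)
  qed
  then show ?thesis by (auto simp: bounded_degree_def)
qed

lemma ps_mult_commute: "ps_mult f g = ps_mult g f"
proof
  fix m
  show "ps_mult f g m = ps_mult g f m"
    unfolding ps_mult_def
    by (rule sum.reindex_bij_witness[of _ prod.swap prod.swap])
       (auto simp: decomps_def add.commute mult.commute)
qed

lemma ps_mult_assoc: "ps_mult (ps_mult f g) h = ps_mult f (ps_mult g h)"
proof
  fix m
  have "ps_mult (ps_mult f g) h m =
      (\<Sum>(p, q) \<in> Sigma (decomps m) (\<lambda>p. decomps (fst p)). f (fst q) * g (snd q) * h (snd p))"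
    unfolding ps_mult_def
    by (subst sum.Sigma[symmetric]) (auto simp: finite_decomps sum_distrib_right split_def)
  also have "\<dots> = (\<Sum>(p, q) \<in> Sigma (decomps m) (\<lambda>p. decomps (snd p)). f (fst p) * (g (fst q) * h (snd q)))"
    by (rule sum.reindex_bij_witness
          [of _ "\<lambda>(p, q). ((fst p + fst q, snd q), (fst p, fst q))"
                "\<lambda>(p, q). ((fst q, snd q + snd p), (snd q, snd p))"])
       (auto simp: decomps_def algebra_simps)
  also have "\<dots> = ps_mult f (ps_mult g h) m"
    unfolding ps_mult_def
    by (subst sum.Sigma[symmetric]) (auto simp: finite_decomps sum_distrib_left split_def)
  finally show "ps_mult (ps_mult f g) h m = ps_mult f (ps_mult g h) m" .
qed

lemma ps_mult_distrib: "ps_mult (\<lambda>m. f m + g m) h = (\<lambda>m. ps_mult f h m + ps_mult g h m)"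
proof
  fix m
  show "ps_mult (\<lambda>m. f m + g m) h m = ps_mult f h m + ps_mult g h m"
    unfolding ps_mult_def by (simp only: split_def distrib_right sum.distrib)
qed

lemma exponents_eq_Nil_iff [simp]: "exponents m = [] \<longleftrightarrow> m = 0"
  by (simp add: exponents_def)

lemma exponents_0 [simp]: "exponents 0 = []"
  by simp

lemma ps_mult_one: "ps_mult (\<lambda>m. if m = 0 then 1 else 0) f = f"
proof
  fix m
  have "ps_mult (\<lambda>m. if m = 0 then 1 else 0) f m = (\<Sum>(a, b) \<in> {(0 :: nat \<Rightarrow>\<^sub>0 nat, m)}. f b)"
    unfolding ps_mult_def
    by (rule sum.mono_neutral_cong_right) (auto simp: finite_decomps, auto simp: decomps_def split: if_splits)
  then show "ps_mult (\<lambda>m. if m = 0 then 1 else 0) f m = f m" by simp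
qed

lemma qsym_pointwise:
  assumes f: "quasi_symmetric f \<and> bounded_degree f" and g: "quasi_symmetric g \<and> bounded_degree g"
    and c: "c 0 0 = 0"
  shows "quasi_symmetric (\<lambda>m. c (f m) (g m)) \<and> bounded_degree (\<lambda>m. c (f m) (g m))"
proof
  show "quasi_symmetric (\<lambda>m. c (f m) (g m))"
    unfolding quasi_symmetric_def
  proof (intro allI impI)
    fix m m' :: "nat \<Rightarrow>\<^sub>0 nat"
    assume "exponents m = exponents m'"
    then have "f m = f m'" "g m = g m'" using f g unfolding quasi_symmetric_def by blast+
    then show "c (f m) (g m) = c (f m') (g m')" by (rule arg_cong2)
  qed
  obtain d e where d: "\<And>m. f m \<noteq> 0 \<Longrightarrow> sum_list (exponents m) \<le> d"
    and e: "\<And>m. g m \<noteq> 0 \<Longrightarrow> sum_list (exponents m) \<le> e"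
    using f g unfolding bounded_degree_def by metis
  have "sum_list (exponents m) \<le> max d e" if "c (f m) (g m) \<noteq> 0" for m
  proof -
    have "f m \<noteq> 0 \<or> g m \<noteq> 0" using that c by auto
    then show ?thesis using d[of m] e[of m] by (meson max.coboundedI1 max.coboundedI2)
  qed
  then show "bounded_degree (\<lambda>m. c (f m) (g m))" unfolding bounded_degree_def by blast
qed

instantiation qsym :: comm_ring_1
begin

lift_definition zero_qsym :: qsym is "\<lambda>_. 0"
  by (simp add: quasi_symmetric_def bounded_degree_def)

lift_definition one_qsym :: qsym is "\<lambda>m. if m = 0 then 1 else 0"
proof (intro conjI)
  show "quasi_symmetric (\<lambda>m. if m = 0 then 1 else 0)"
    unfolding quasi_symmetric_def by (metis exponents_eq_Nil_iff)
  show "bounded_degree (\<lambda>m. if m = 0 then 1 else 0)"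
    unfolding bounded_degree_def by (rule exI[of _ 0]) simp
qed

lift_definition plus_qsym :: "qsym \<Rightarrow> qsym \<Rightarrow> qsym" is "\<lambda>f g m. f m + g m"
  by (erule (1) qsym_pointwise[where c = "(+)"]) simp

lift_definition uminus_qsym :: "qsym \<Rightarrow> qsym" is "\<lambda>f m. - f m"
  by (frule (1) qsym_pointwise[where c = "\<lambda>a _. - a"]) simp_all

lift_definition minus_qsym :: "qsym \<Rightarrow> qsym \<Rightarrow> qsym" is "\<lambda>f g m. f m - g m"
  by (erule (1) qsym_pointwise[where c = "(-)"]) simp

lift_definition times_qsym :: "qsym \<Rightarrow> qsym \<Rightarrow> qsym" is ps_mult
  by (simp add: quasi_symmetric_ps_mult bounded_degree_ps_mult)

instance
proof
  fix a b c :: qsym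
  show "a * b * c = a * (b * c)" by transfer (rule ps_mult_assoc)
  show "a * b = b * a" by transfer (rule ps_mult_commute)
  show "1 * a = a" by transfer (rule ps_mult_one)
  show "(a + b) * c = a * c + b * c"
    by transfer (rule ps_mult_distrib)
  show "(0::qsym) \<noteq> 1" by transfer (auto simp: fun_eq_iff)
  show "a + b + c = a + (b + c)" by transfer (rule ext, simp)
  show "a + b = b + a" by transfer (rule ext, simp)
  show "0 + a = a" by transfer (rule ext, simp)
  show "- a + a = 0" by transfer (rule ext, simp)
  show "a - b = a + - b" by transfer (rule ext, simp)
qed

end


subsection \<open>The monomial basis and the coalgebra structure\<close>

lift_definition Mbasis :: "composition \<Rightarrow> qsym" is "\<lambda>\<alpha> m. if exponents m = \<alpha> then 1 else 0"
  by (auto simp: quasi_symmetric_def bounded_degree_def)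

text \<open>
  The coefficient of \<open>M\<^sub>\<alpha>\<close> in \<open>f\<close> is the coefficient of \<open>z\<^sub>0\<^bsup>\<alpha>\<^sub>1\<^esup> z\<^sub>1\<^bsup>\<alpha>\<^sub>2\<^esup> \<cdots>\<close> in \<open>f\<close>.
\<close>

definition Mcoeff :: "qsym \<Rightarrow> composition \<Rightarrow> int" where
  "Mcoeff f \<alpha> = mcoeff f (Poly_Mapping.nth (parts \<alpha>))"

text \<open>The pairing of \<open>QSym\<close> with \<open>NC\<close> making \<open>M\<^sub>\<alpha>\<close> and \<open>S\<^sup>\<alpha>\<close> dual bases.\<close>

definition qsym_pairing :: "qsym \<Rightarrow> nc \<Rightarrow> int" where
  "qsym_pairing f \<Psi> = (\<Sum>\<alpha> \<in> Poly_Mapping.keys \<Psi>. Poly_Mapping.lookup \<Psi> \<alpha> * Mcoeff f \<alpha>)"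

text \<open>
  The coproduct is dual to the product \<open>S\<^sup>\<beta> S\<^sup>\<gamma> = S\<^bsup>\<beta>\<gamma>\<^esup>\<close> of \<open>NC\<close>:
  \<open>\<Delta> M\<^sub>\<alpha>\<close> is the sum of \<open>M\<^sub>\<beta> \<otimes> M\<^sub>\<gamma>\<close> over all \<open>\<beta>\<gamma> = \<alpha>\<close>.
\<close>

definition qsym_coprod :: "qsym \<Rightarrow> (qsym, qsym) tensor" where
  "qsym_coprod f =
     (\<Sum>\<alpha> | Mcoeff f \<alpha> \<noteq> 0. \<Sum>(\<beta>, \<gamma>) | \<beta> + \<gamma> = \<alpha>. (of_int (Mcoeff f \<alpha>) * Mbasis \<beta>) \<otimes>\<^sub>t Mbasis \<gamma>)"

definition qsym_counit :: "qsym \<Rightarrow> int" where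
  "qsym_counit f = Mcoeff f 0"


section \<open>Graded posets and Pieri operators\<close>

class graded_poset = order +
  fixes rk :: "'a \<Rightarrow> nat"
  assumes rk_less: "x < y \<Longrightarrow> rk x < rk y"
    and rk_cover: "x < y \<Longrightarrow> \<not> (\<exists>z. x < z \<and> z < y) \<Longrightarrow> rk y = rk x + 1"
    and finite_interval: "finite {z. x \<le> z \<and> z \<le> y}"

text \<open>\<open>hbar k v\<close> is \<open>v.hbar\<^sub>k\<close>; the value at \<open>k = 0\<close> is never used.\<close>

definition pieri_operators ::
    "(nat \<Rightarrow> ('p::graded_poset \<Rightarrow>\<^sub>0 int) \<Rightarrow> ('p \<Rightarrow>\<^sub>0 int)) \<Rightarrow> bool" where
  "pieri_operators hbar \<longleftrightarrow>
     (\<forall>k>0. additive (hbar k) \<and>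
        (\<forall>x. \<forall>y \<in> Poly_Mapping.keys (hbar k (frag_of x)). x < y \<and> rk y = rk x + k))"

text \<open>The right action of \<open>NC\<close> on \<open>\<int>P\<close>: \<open>v.S\<^sup>\<alpha> = (\<cdots>(v.hbar\<^bsub>\<alpha>\<^sub>1\<^esub>)\<cdots>).hbar\<^bsub>\<alpha>\<^sub>l\<^esub>\<close>.\<close>

definition zp_act ::
    "(nat \<Rightarrow> ('p \<Rightarrow>\<^sub>0 int) \<Rightarrow> ('p \<Rightarrow>\<^sub>0 int)) \<Rightarrow> ('p \<Rightarrow>\<^sub>0 int) \<Rightarrow> nc \<Rightarrow> ('p \<Rightarrow>\<^sub>0 int)" where
  "zp_act hbar v = frag_extend (\<lambda>\<alpha>. fold hbar (parts \<alpha>) v)"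

text \<open>
  Elements of \<open>P\<^sup>k\<close> are lists of length \<open>k\<close>, and \<open>zp_cons\<close> is the isomorphism
  \<open>\<int>P \<otimes> \<int>(P\<^sup>k) \<rightarrow> \<int>(P\<^bsup>k+1\<^esup>)\<close>.  The coproduct of \<open>NC\<close> is iterated in the form
  \<open>\<Delta>\<^bsup>(k+1)\<^esup> = (id \<otimes> \<Delta>\<^bsup>(k)\<^esup>) \<circ> \<Delta>\<close>, where \<open>\<Delta>\<^bsup>(0)\<^esup>\<close> is the counit.
\<close>

definition zp_cons :: "('p \<Rightarrow>\<^sub>0 int) \<Rightarrow> ('p list \<Rightarrow>\<^sub>0 int) \<Rightarrow> ('p list \<Rightarrow>\<^sub>0 int)" where
  "zp_cons u v = frag_extend (\<lambda>y. frag_extend (\<lambda>ys. frag_of (y # ys)) v) u"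

primrec zpow_act ::
    "(nat \<Rightarrow> ('p \<Rightarrow>\<^sub>0 int) \<Rightarrow> ('p \<Rightarrow>\<^sub>0 int)) \<Rightarrow> 'p list \<Rightarrow> nc \<Rightarrow> ('p list \<Rightarrow>\<^sub>0 int)" where
  "zpow_act hbar [] \<Psi> = frag_cmul (nc_counit \<Psi>) (frag_of [])"
| "zpow_act hbar (x # xs) \<Psi> =
     frag_extend (\<lambda>(\<beta>, \<gamma>). zp_cons (zp_act hbar (frag_of x) (frag_of \<beta>)) (zpow_act hbar xs (frag_of \<gamma>)))
       (nc_coprod \<Psi>)"


section \<open>The Hopf algebra of intervals\<close>

text \<open>
  \<open>Intervals [(x\<^sub>1, y\<^sub>1), \<dots>, (x\<^sub>k, y\<^sub>k)]\<close> is the Cartesian product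
  \<open>[x\<^sub>1, y\<^sub>1] \<times> \<cdots> \<times> [x\<^sub>k, y\<^sub>k]\<close>; a factor is empty if \<open>x\<^sub>i \<le> y\<^sub>i\<close> fails.
\<close>

datatype 'p intervals = Intervals (factors: "('p \<times> 'p) list")

instantiation intervals :: (type) monoid_add
begin

definition zero_intervals :: "'a intervals" where
  "zero_intervals = Intervals []"

definition plus_intervals :: "'a intervals \<Rightarrow> 'a intervals \<Rightarrow> 'a intervals" where
  "plus_intervals A B = Intervals (factors A @ factors B)"

instance by standard (simp_all add: zero_intervals_def plus_intervals_def)

end

text \<open>
  Singleton factors are identified with the unit (the empty product) and products with an empty
  factor with \<open>0\<close>.
\<close>

inductive_set hp_rel :: "('p::graded_poset intervals \<Rightarrow>\<^sub>0 int) set" where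
  zero: "0 \<in> hp_rel"
| diff: "u \<in> hp_rel \<Longrightarrow> v \<in> hp_rel \<Longrightarrow> u - v \<in> hp_rel"
| singleton: "frag_of (A + Intervals [(x, x)] + B) - frag_of (A + B) \<in> hp_rel"
| empty: "\<not> x \<le> y \<Longrightarrow> frag_of (A + Intervals [(x, y)] + B) \<in> hp_rel"

lemma hp_rel_minus: "u \<in> hp_rel \<Longrightarrow> - u \<in> hp_rel"
  using hp_rel.diff[OF hp_rel.zero] by simp

lemma hp_rel_add: "u \<in> hp_rel \<Longrightarrow> v \<in> hp_rel \<Longrightarrow> u + v \<in> hp_rel"
  using hp_rel.diff[OF _ hp_rel_minus] by fastforce

lemma hp_rel_mult_right:
  assumes "u \<in> hp_rel" shows "u * v \<in> hp_rel"
  using subset_UNIV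
proof (induction v rule: frag_induction)
  case (one C)
  from assms show ?case
  proof induction
    case (singleton A x B)
    show ?case using hp_rel.singleton[of A x "B + C"]
      by (simp add: left_diff_distrib mult_single add.assoc)
  next
    case (empty x y A B)
    show ?case using hp_rel.empty[OF empty, of A "B + C"] by (simp add: mult_single add.assoc)
  qed (simp_all add: left_diff_distrib hp_rel.zero hp_rel.diff)
qed (simp_all add: right_diff_distrib hp_rel.zero hp_rel.diff)

lemma hp_rel_mult_left:
  assumes "u \<in> hp_rel" shows "v * u \<in> hp_rel"
  using subset_UNIV
proof (induction v rule: frag_induction)
  case (one C)
  from assms show ?case
  proof induction
    case (singleton A x B)
    show ?case using hp_rel.singleton[of "C + A" x B]
      by (simp add: right_diff_distrib mult_single add.assoc)
  next
    case (empty x y A B)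
    show ?case using hp_rel.empty[OF empty, of "C + A" B] by (simp add: mult_single add.assoc)
  qed (simp_all add: right_diff_distrib hp_rel.zero hp_rel.diff)
qed (simp_all add: left_diff_distrib hp_rel.zero hp_rel.diff)

quotient_type (overloaded) 'p hp =
    "'p::graded_poset intervals \<Rightarrow>\<^sub>0 int" / "\<lambda>u v. u - v \<in> hp_rel"
proof (rule equivpI)
  show "reflp (\<lambda>u v :: 'p intervals \<Rightarrow>\<^sub>0 int. u - v \<in> hp_rel)"
    by (simp add: reflp_def hp_rel.zero)
  show "symp (\<lambda>u v :: 'p intervals \<Rightarrow>\<^sub>0 int. u - v \<in> hp_rel)"
    by (auto intro!: sympI dest: hp_rel_minus)
  show "transp (\<lambda>u v :: 'p intervals \<Rightarrow>\<^sub>0 int. u - v \<in> hp_rel)"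
    by (auto intro!: transpI dest: hp_rel_add)
qed

text \<open>\<open>degree\<close> is the rank of a nonempty product of intervals.\<close>

definition nonempty_intervals :: "'p::graded_poset intervals \<Rightarrow> bool" where
  "nonempty_intervals A \<longleftrightarrow> (\<forall>(x, y) \<in> set (factors A). x \<le> y)"

definition degree :: "'p::graded_poset intervals \<Rightarrow> nat" where
  "degree A = (\<Sum>(x, y) \<leftarrow> factors A. rk y - rk x)"

definition counit_basis :: "'p::graded_poset intervals \<Rightarrow> int" where
  "counit_basis A = (if nonempty_intervals A \<and> degree A = 0 then 1 else 0)"

lemma counit_basis_rel: "u \<in> hp_rel \<Longrightarrow> free_lift counit_basis u = 0"
  by (induction rule: hp_rel.induct)
     (simp_all add: free_lift_diff counit_basis_def nonempty_intervals_def degree_def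
       plus_intervals_def)

instantiation hp :: (graded_poset) ring_1
begin

lift_definition zero_hp :: "'a hp" is 0 .

lift_definition one_hp :: "'a hp" is 1 .

lift_definition plus_hp :: "'a hp \<Rightarrow> 'a hp \<Rightarrow> 'a hp" is "(+)"
  by (auto dest: hp_rel_add simp: algebra_simps)

lift_definition uminus_hp :: "'a hp \<Rightarrow> 'a hp" is uminus
  by (auto dest: hp_rel_minus simp: algebra_simps)

lift_definition minus_hp :: "'a hp \<Rightarrow> 'a hp \<Rightarrow> 'a hp" is minus
  by (drule (1) hp_rel.diff) (simp add: algebra_simps)

lift_definition times_hp :: "'a hp \<Rightarrow> 'a hp \<Rightarrow> 'a hp" is "(*)"
proof -
  fix u u' v v' :: "'a intervals \<Rightarrow>\<^sub>0 int"
  assume "u - u' \<in> hp_rel" "v - v' \<in> hp_rel"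
  then have "(u - u') * v + u' * (v - v') \<in> hp_rel"
    by (intro hp_rel_add hp_rel_mult_left hp_rel_mult_right)
  then show "u * v - u' * v' \<in> hp_rel" by (simp add: algebra_simps)
qed

instance
proof
  have one: "(1 :: 'a intervals \<Rightarrow>\<^sub>0 int) = frag_of 0" by (rule single_one[symmetric])
  have "(0 :: 'a intervals \<Rightarrow>\<^sub>0 int) - 1 \<notin> hp_rel"
  proof
    assume "(0 :: 'a intervals \<Rightarrow>\<^sub>0 int) - 1 \<in> hp_rel"
    from counit_basis_rel[OF this] show False
      by (simp only: free_lift_diff one free_lift_frag_of)
         (simp add: counit_basis_def nonempty_intervals_def degree_def zero_intervals_def)
  qed
  then show "(0 :: 'a hp) \<noteq> 1" by transfer
qed (transfer; simp add: algebra_simps hp_rel.zero)+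

end

lift_definition hp_of :: "'p::graded_poset intervals \<Rightarrow> 'p hp" is frag_of .

text \<open>
  The linear map on \<open>HP\<close> with prescribed values on products of intervals, provided that these respect
  the identifications in \<open>hp_rel\<close>.  That this is the case for the coproduct, the counit and \<open>K\<close> is
  shown at the end (\<open>hp_coprod_of\<close>, \<open>hp_counit_of\<close>, \<open>K_map_of\<close>).
\<close>

definition hp_lift :: "('p::graded_poset intervals \<Rightarrow> 'c::ab_group_add) \<Rightarrow> 'p hp \<Rightarrow> 'c" where
  "hp_lift f = (THE \<phi>. additive \<phi> \<and> (\<forall>A. \<phi> (hp_of A) = f A))"

lemma hp_lift_unique:
  fixes f :: "'p::graded_poset intervals \<Rightarrow> 'c::ab_group_add"
  assumes "\<And>A x B. f (A + Intervals [(x, x)] + B) = f (A + B)"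
    and "\<And>A x y B. \<not> x \<le> y \<Longrightarrow> f (A + Intervals [(x, y)] + B) = 0"
  shows "\<exists>!\<phi>. additive \<phi> \<and> (\<forall>A. \<phi> (hp_of A) = f A)"
proof -
  have rel: "free_lift f u = 0" if "u \<in> hp_rel" for u
    using that by (induction rule: hp_rel.induct) (simp_all add: free_lift_diff assms)
  define \<phi> where "\<phi> t = free_lift f (rep_hp t)" for t
  have abs: "\<phi> (abs_hp u) = free_lift f u" for u
  proof -
    have "rep_hp (abs_hp u) - u \<in> hp_rel"
      using rep_abs_rsp_left[OF Quotient3_hp, of u u] by (simp add: hp_rel.zero)
    then show ?thesis using rel free_lift_diff[of f] unfolding \<phi>_def by fastforce
  qed
  show ?thesis
  proof (rule ex1I[of _ \<phi>], intro conjI allI)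
    have "\<phi> (s + t) = \<phi> s + \<phi> t" for s t
      by (induction s, induction t) (simp add: plus_hp.abs_eq abs free_lift_add)
    then show "additive \<phi>" by unfold_locales
    show "\<phi> (hp_of A) = f A" for A by (simp add: hp_of.abs_eq abs)
  next
    fix \<psi> assume \<psi>: "additive \<psi> \<and> (\<forall>A. \<psi> (hp_of A) = f A)"
    show "\<psi> = \<phi>"
    proof
      fix t
      obtain u :: "'p intervals \<Rightarrow>\<^sub>0 int" where t: "t = abs_hp u" by (induction t) auto
      have "\<psi> (abs_hp u) = free_lift f u"
      proof (rule additive_free_ext)
        show "additive (\<lambda>u. \<psi> (abs_hp u))"
          by unfold_locales (metis \<psi> additive.add plus_hp.abs_eq)
        show "additive (free_lift f)" by unfold_locales (rule free_lift_add)
        show "\<psi> (abs_hp (frag_of A)) = free_lift f (frag_of A)" for A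
          using \<psi> by (simp flip: hp_of.abs_eq)
      qed
      then show "\<psi> t = \<phi> t" by (simp add: t abs)
    qed
  qed
qed

definition lower :: "'p intervals \<Rightarrow> 'p list" where
  "lower A = map fst (factors A)"

definition upper :: "'p intervals \<Rightarrow> 'p list" where
  "upper A = map snd (factors A)"

definition elements :: "'p::graded_poset intervals \<Rightarrow> 'p list set" where
  "elements A = {zs. list_all2 (\<lambda>(x, y) z. x \<le> z \<and> z \<le> y) (factors A) zs}"

text \<open>The interval \<open>[xs, ys]\<close> of \<open>P\<^sup>k\<close>, for \<open>xs\<close> and \<open>ys\<close> of length \<open>k\<close>.\<close>

definition interval :: "'p list \<Rightarrow> 'p list \<Rightarrow> 'p intervals" where
  "interval xs ys = Intervals (zip xs ys)"

definition hp_coprod :: "'p::graded_poset hp \<Rightarrow> ('p hp, 'p hp) tensor" where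
  "hp_coprod = hp_lift (\<lambda>A.
     \<Sum>zs \<in> elements A. hp_of (interval (lower A) zs) \<otimes>\<^sub>t hp_of (interval zs (upper A)))"

definition hp_counit :: "'p::graded_poset hp \<Rightarrow> int" where
  "hp_counit = hp_lift counit_basis"


section \<open>The map from intervals to quasi-symmetric functions\<close>

definition K_basis ::
    "(nat \<Rightarrow> ('p::graded_poset \<Rightarrow>\<^sub>0 int) \<Rightarrow> ('p \<Rightarrow>\<^sub>0 int)) \<Rightarrow> 'p intervals \<Rightarrow> qsym" where
  "K_basis hbar A =
     (THE f. \<forall>\<Psi>. qsym_pairing f \<Psi> = Poly_Mapping.lookup (zpow_act hbar (lower A) \<Psi>) (upper A))"

definition K_map ::
    "(nat \<Rightarrow> ('p::graded_poset \<Rightarrow>\<^sub>0 int) \<Rightarrow> ('p \<Rightarrow>\<^sub>0 int)) \<Rightarrow> 'p hp \<Rightarrow> qsym" where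
  "K_map hbar = hp_lift (K_basis hbar)"


section \<open>Well-definedness of the linear extensions\<close>

lemma hp_of_singleton: "hp_of (A + Intervals [(x, x)] + B) = hp_of (A + B)"
  by transfer (rule hp_rel.singleton)

lemma hp_of_empty: "\<not> x \<le> y \<Longrightarrow> hp_of (A + Intervals [(x, y)] + B) = 0"
  by transfer (simp add: hp_rel.empty)

lemma hp_lift_of:
  assumes "\<And>A x B. f (A + Intervals [(x, x)] + B) = f (A + B)"
    and "\<And>A x y B. \<not> x \<le> y \<Longrightarrow> f (A + Intervals [(x, y)] + B) = 0"
  shows "additive (hp_lift f)" "hp_lift f (hp_of A) = f A"
  using theI'[OF hp_lift_unique[OF assms]] unfolding hp_lift_def by blast+

lemma hp_counit_of: "additive hp_counit" "hp_counit (hp_of A) = counit_basis A"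
  unfolding hp_counit_def
  by (rule hp_lift_of; simp add: counit_basis_def nonempty_intervals_def degree_def plus_intervals_def)+

lemma hp_coprod_of:
  fixes A :: "'p::graded_poset intervals"
  shows "additive (hp_coprod :: 'p hp \<Rightarrow> _)"
    and "hp_coprod (hp_of A) =
     (\<Sum>zs \<in> elements A. hp_of (interval (lower A) zs) \<otimes>\<^sub>t hp_of (interval zs (upper A)))"
proof -
  let ?f = "\<lambda>A :: 'p intervals. \<Sum>zs \<in> elements A. hp_of (interval (lower A) zs) \<otimes>\<^sub>t hp_of (interval zs (upper A))"
  have sing: "?f (A + Intervals [(x, x)] + B) = ?f (A + B)" for A B :: "'p intervals" and x
  proof -
    let ?n = "length (factors A)"
    have split: "\<exists>us vs. zs = us @ vs \<and> length us = ?n \<and> us \<in> elements A \<and> vs \<in> elements B"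
      if "zs \<in> elements (A + B)" for zs
      using that unfolding elements_def plus_intervals_def mem_Collect_eq intervals.sel list_all2_append1
      by blast
    have split': "\<exists>us vs. zs = us @ x # vs \<and> length us = ?n \<and> us \<in> elements A \<and> vs \<in> elements B"
      if "zs \<in> elements (A + Intervals [(x, x)] + B)" for zs
    proof -
      have "list_all2 (\<lambda>(x, y) z. x \<le> z \<and> z \<le> y) (factors A @ (x, x) # factors B) zs"
        using that by (simp add: elements_def plus_intervals_def)
      then obtain us ws where "zs = us @ ws" "length us = ?n" "us \<in> elements A"
        "list_all2 (\<lambda>(x, y) z. x \<le> z \<and> z \<le> y) ((x, x) # factors B) ws"
        unfolding list_all2_append1 elements_def by blast
      moreover from this(4) obtain z vs where "ws = z # vs" "x \<le> z" "z \<le> x" "vs \<in> elements B"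
        unfolding list_all2_Cons1 elements_def by auto
      moreover from this have "z = x" by simp
      ultimately show ?thesis by blast
    qed
    have join: "us @ vs \<in> elements (A + B)" "us @ x # vs \<in> elements (A + Intervals [(x, x)] + B)"
      if "us \<in> elements A" "vs \<in> elements B" for us vs
      using that by (auto simp: elements_def plus_intervals_def intro: list_all2_appendI)
    have I: "hp_of (interval (lower (A + Intervals [(x, x)] + B)) (us @ x # vs)) =
        hp_of (interval (lower (A + B)) (us @ vs))"
      "hp_of (interval (us @ x # vs) (upper (A + Intervals [(x, x)] + B))) =
        hp_of (interval (us @ vs) (upper (A + B)))"
      if "length us = length (factors A)" for us vs
      using that hp_of_singleton[of "Intervals (zip (map fst (factors A)) us)" x "Intervals (zip (map fst (factors B)) vs)"]
        hp_of_singleton[of "Intervals (zip us (map snd (factors A)))" x "Intervals (zip vs (map snd (factors B)))"]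
      by (simp_all add: interval_def lower_def upper_def plus_intervals_def)
    have len: "length us = ?n" if "us \<in> elements A" for us
      using that list_all2_lengthD by (fastforce simp: elements_def)
    show ?thesis
    proof (rule sum.reindex_bij_witness[of _ "\<lambda>zs. take ?n zs @ x # drop ?n zs" "\<lambda>zs. take ?n zs @ drop (Suc ?n) zs"])
      fix zs assume "zs \<in> elements (A + Intervals [(x, x)] + B)"
      then obtain us vs where zs: "zs = us @ x # vs" "length us = ?n" "us \<in> elements A" "vs \<in> elements B"
        using split' by blast
      then have t: "take ?n zs = us" "drop (Suc ?n) zs = vs" by simp_all
      from zs show "take ?n (take ?n zs @ drop (Suc ?n) zs) @ x # drop ?n (take ?n zs @ drop (Suc ?n) zs) = zs"
        by (simp add: t)
      from zs(3,4) show "take ?n zs @ drop (Suc ?n) zs \<in> elements (A + B)" by (simp only: t) (rule join)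
      from zs(2) show "hp_of (interval (lower (A + B)) (take ?n zs @ drop (Suc ?n) zs)) \<otimes>\<^sub>t
            hp_of (interval (take ?n zs @ drop (Suc ?n) zs) (upper (A + B))) =
          hp_of (interval (lower (A + Intervals [(x, x)] + B)) zs) \<otimes>\<^sub>t
            hp_of (interval zs (upper (A + Intervals [(x, x)] + B)))"
        unfolding t unfolding zs(1) by (simp only: I)
    next
      fix zs assume "zs \<in> elements (A + B)"
      then obtain us vs where zs: "zs = us @ vs" "length us = ?n" "us \<in> elements A" "vs \<in> elements B"
        using split by blast
      then have t: "take ?n zs = us" "drop ?n zs = vs" by simp_all
      from zs show "take ?n (take ?n zs @ x # drop ?n zs) @ drop (Suc ?n) (take ?n zs @ x # drop ?n zs) = zs"
        by (simp add: t)
      from zs(3,4) show "take ?n zs @ x # drop ?n zs \<in> elements (A + Intervals [(x, x)] + B)" by (simp only: t) (rule join)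
    qed
  qed
  have emp: "?f (A + Intervals [(x, y)] + B) = 0" if "\<not> x \<le> y" for A B :: "'p intervals" and x y
  proof -
    have "elements (A + Intervals [(x, y)] + B) = {}"
      using that by (fastforce simp: elements_def plus_intervals_def list_all2_append1 list_all2_Cons1)
    then show ?thesis by simp
  qed
  show "additive (hp_coprod :: 'p hp \<Rightarrow> _)" "hp_coprod (hp_of A) = ?f A"
    unfolding hp_coprod_def by (rule hp_lift_of[where f = ?f, OF sing emp]; assumption)+
qed

lemma lookup_frag_extend:
  "Poly_Mapping.lookup (frag_extend f u) y =
     (\<Sum>x \<in> Poly_Mapping.keys u. Poly_Mapping.lookup u x * Poly_Mapping.lookup (f x) y)"
  by (simp add: frag_extend_def lookup_sum)

lemma keys_nc_coprod:
  "(\<beta>, \<gamma>) \<in> Poly_Mapping.keys (nc_coprod (frag_of \<alpha>)) \<Longrightarrow>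
     sum_list (parts \<beta>) + sum_list (parts \<gamma>) = sum_list (parts \<alpha>)"
proof -
  have gen: "sum_list (parts \<beta>) + sum_list (parts \<gamma>) = k"
    if bg: "(\<beta>, \<gamma>) \<in> Poly_Mapping.keys (nc_coprod_gen k)" for \<beta> \<gamma> k
  proof -
    obtain i where "i \<le> k" "(\<beta>, \<gamma>) = (h_index i, h_index (k - i))"
      using subsetD[OF keys_sum bg[unfolded nc_coprod_gen_def]] by auto
    moreover have "sum_list (parts (h_index i)) = i" for i
      by (simp add: h_index_def zero_composition.rep_eq composition_inverse)
    ultimately show ?thesis by simp
  qed
  have *: "sum_list (parts \<beta>) + sum_list (parts \<gamma>) = sum_list ks"
    if "(\<beta>, \<gamma>) \<in> Poly_Mapping.keys (prod_list (map nc_coprod_gen ks))" for ks \<beta> \<gamma>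
    using that
  proof (induction ks arbitrary: \<beta> \<gamma>)
    case Nil
    then show ?case by (simp add: zero_prod_def zero_composition.rep_eq)
  next
    case (Cons k ks)
    then obtain p q where p: "p \<in> Poly_Mapping.keys (nc_coprod_gen k)"
      and q: "q \<in> Poly_Mapping.keys (prod_list (map nc_coprod_gen ks))" and "(\<beta>, \<gamma>) = p + q"
      using keys_mult[of "nc_coprod_gen k" "prod_list (map nc_coprod_gen ks)"] by auto
    then show ?case using gen[of "fst p" "snd p" k] Cons.IH[of "fst q" "snd q"]
      by (cases p; cases q) (simp add: plus_composition.rep_eq)
  qed
  show "(\<beta>, \<gamma>) \<in> Poly_Mapping.keys (nc_coprod (frag_of \<alpha>)) \<Longrightarrow> ?thesis"
    by (simp add: nc_coprod_def *)
qed

lemma composition_eq_0_iff: "\<alpha> = 0 \<longleftrightarrow> sum_list (parts \<alpha>) = 0"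
  using parts[of \<alpha>] by (auto simp: parts_inject[symmetric] zero_composition.rep_eq)
    (metis list.set_intros(1) neq_Nil_conv)

lemma composition_add_eq_0_iff: "\<alpha> + \<beta> = 0 \<longleftrightarrow> \<alpha> = 0 \<and> \<beta> = (0 :: composition)"
  by transfer simp

lemma lookup_nc_coprod_0:
  "Poly_Mapping.lookup (nc_coprod (frag_of \<alpha>)) (0, \<gamma>) = (if \<gamma> = \<alpha> then 1 else 0)"
proof -
  define E :: "(composition \<times> composition \<Rightarrow>\<^sub>0 int) \<Rightarrow> nc"
    where "E = frag_extend (\<lambda>(\<beta>, \<gamma>). if \<beta> = 0 then frag_of \<gamma> else 0)"
  have E_mult: "E (u * v) = E u * E v" for u v
    using subset_UNIV
  proof (induction u rule: frag_induction)
    case (one p)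
    show ?case using subset_UNIV
      by (induction v rule: frag_induction)
         (auto simp: E_def mult_single right_diff_distrib frag_extend_diff composition_add_eq_0_iff
            split: prod.splits)
  qed (simp_all add: E_def left_diff_distrib frag_extend_diff)
  have E_gen: "E (nc_coprod_gen k) = frag_of (h_index k)" for k
  proof -
    have h0: "h_index i = 0 \<longleftrightarrow> i = 0" for i
      by (simp add: composition_eq_0_iff) (simp add: h_index_def zero_composition.rep_eq composition_inverse)
    have "E (nc_coprod_gen k) = (\<Sum>i\<le>k. if i = 0 then frag_of (h_index k) else 0)"
      unfolding nc_coprod_gen_def E_def
      by (subst frag_extend_sum) (auto intro!: sum.cong simp: h0)
    then show ?thesis by simp
  qed
  have "E (prod_list (map nc_coprod_gen ks)) = frag_of (composition ks)" if "0 \<notin> set ks" for ks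
    using that
  proof (induction ks)
    case Nil
    have "E 1 = E (frag_of (0, 0))" by (simp flip: zero_prod_def)
    also have "\<dots> = frag_of 0" by (simp add: E_def)
    finally show ?case by (simp add: zero_composition_def)
  next
    case (Cons k ks)
    have "h_index k + composition ks = composition (k # ks)"
      using Cons.prems by (simp add: parts_inject[symmetric] plus_composition.rep_eq h_index_def composition_inverse)
    then show ?case using Cons by (simp add: E_mult E_gen mult_single)
  qed
  from this[of "parts \<alpha>"] parts[of \<alpha>] have "E (nc_coprod (frag_of \<alpha>)) = frag_of \<alpha>"
    by (simp add: nc_coprod_def parts_inverse)
  moreover have "Poly_Mapping.lookup (E u) \<gamma> = Poly_Mapping.lookup u (0, \<gamma>)" for u
    using subset_UNIV
    by (induction u rule: frag_induction) (auto simp: E_def frag_extend_diff lookup_minus split: if_splits)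
  ultimately show ?thesis by (metis lookup_frag_of)
qed

lemma lookup_zp_cons:
  "Poly_Mapping.lookup (zp_cons u v) (y # ys) = Poly_Mapping.lookup u y * Poly_Mapping.lookup v ys"
proof -
  have 1: "Poly_Mapping.lookup (frag_extend (\<lambda>ys. frag_of (z # ys)) v) (y # ys) =
      (if z = y then Poly_Mapping.lookup v ys else 0)" for z
    using subset_UNIV
    by (induction v rule: frag_induction) (auto simp: frag_extend_diff lookup_minus)
  show ?thesis
    unfolding zp_cons_def using subset_UNIV
    by (induction u rule: frag_induction) (auto simp: frag_extend_diff lookup_minus left_diff_distrib 1)
qed

lemma lookup_zp_cons_Nil [simp]: "Poly_Mapping.lookup (zp_cons u v) [] = 0"
proof -
  have 1: "Poly_Mapping.lookup (frag_extend (\<lambda>ys. frag_of (z # ys)) v) [] = 0" for z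
    using subset_UNIV
    by (induction v rule: frag_induction) (auto simp: frag_extend_diff lookup_minus)
  show ?thesis
    unfolding zp_cons_def using subset_UNIV
    by (induction u rule: frag_induction) (auto simp: frag_extend_diff lookup_minus 1)
qed

lemma lookup_zpow_act_Cons:
  "Poly_Mapping.lookup (zpow_act hbar (x # xs) \<Psi>) (y # ys) =
     (\<Sum>(\<beta>, \<gamma>) \<in> Poly_Mapping.keys (nc_coprod \<Psi>). Poly_Mapping.lookup (nc_coprod \<Psi>) (\<beta>, \<gamma>) *
        (Poly_Mapping.lookup (zp_act hbar (frag_of x) (frag_of \<beta>)) y *
         Poly_Mapping.lookup (zpow_act hbar xs (frag_of \<gamma>)) ys))"
  by (simp add: lookup_frag_extend lookup_zp_cons split_def)

lemma zpow_act_0: "zpow_act hbar xs 0 = 0"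
  by (cases xs) (simp_all add: nc_counit_def nc_coprod_def)

lemma zpow_act_diff: "zpow_act hbar xs (\<Phi> - \<Psi>) = zpow_act hbar xs \<Phi> - zpow_act hbar xs \<Psi>"
  by (cases xs) (simp_all add: nc_counit_def nc_coprod_def lookup_minus frag_cmul_diff_distrib frag_extend_diff)

lemma zpow_act_expand:
  "Poly_Mapping.lookup (zpow_act hbar xs \<Psi>) ys =
     (\<Sum>\<alpha> \<in> Poly_Mapping.keys \<Psi>. Poly_Mapping.lookup \<Psi> \<alpha> * Poly_Mapping.lookup (zpow_act hbar xs (frag_of \<alpha>)) ys)"
proof -
  have "zpow_act hbar xs \<Psi> = frag_extend (\<lambda>\<alpha>. zpow_act hbar xs (frag_of \<alpha>)) \<Psi>"
    using subset_UNIV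
    by (induction \<Psi> rule: frag_induction) (simp_all add: zpow_act_0 zpow_act_diff frag_extend_diff)
  then show ?thesis by (simp add: lookup_frag_extend)
qed

lemma zp_act_degree:
  fixes x y :: "'p::graded_poset"
  assumes "pieri_operators hbar" and "y \<in> Poly_Mapping.keys (zp_act hbar (frag_of x) (frag_of \<beta>))"
  shows "x \<le> y \<and> rk y = rk x + sum_list (parts \<beta>)"
proof -
  have step: "\<exists>z \<in> Poly_Mapping.keys v. z < y \<and> rk y = rk z + k"
    if k: "0 < k" and y: "y \<in> Poly_Mapping.keys (hbar k v)" for k v y
  proof -
    have add: "additive (hbar k)" using assms(1) k unfolding pieri_operators_def by blast
    have "hbar k v = frag_extend (\<lambda>z. hbar k (frag_of z)) v"
      by (rule additive_free_ext[OF add]) (auto intro: additive.intro simp: frag_extend_add)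
    then obtain z where "z \<in> Poly_Mapping.keys v" "y \<in> Poly_Mapping.keys (hbar k (frag_of z))"
      using y subsetD[OF keys_frag_extend] by (metis UN_E)
    then show ?thesis using assms(1) k unfolding pieri_operators_def by blast
  qed
  have "\<exists>z \<in> Poly_Mapping.keys v. z \<le> y \<and> rk y = rk z + sum_list ks"
    if "0 \<notin> set ks" "y \<in> Poly_Mapping.keys (fold hbar ks v)" for ks v
    using that
  proof (induction ks arbitrary: v)
    case (Cons k ks)
    then obtain z where "z \<in> Poly_Mapping.keys (hbar k v)" "z \<le> y" "rk y = rk z + sum_list ks"
      by auto
    moreover obtain w where "w \<in> Poly_Mapping.keys v" "w < z" "rk z = rk w + k"
      using step[of k z v] Cons.prems \<open>z \<in> Poly_Mapping.keys (hbar k v)\<close> by auto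
    ultimately show ?case by (intro bexI[of _ w]) auto
  qed auto
  from this[of "parts \<beta>" "frag_of x"] assms(2) parts[of \<beta>] show ?thesis by (simp add: zp_act_def)
qed

lemma zpow_act_degree:
  fixes xs ys :: "'p::graded_poset list"
  assumes "pieri_operators hbar" and "Poly_Mapping.lookup (zpow_act hbar xs (frag_of \<alpha>)) ys \<noteq> 0"
  shows "list_all2 (\<le>) xs ys \<and> sum_list (map rk ys) = sum_list (map rk xs) + sum_list (parts \<alpha>)"
  using assms(2)
proof (induction xs arbitrary: ys \<alpha>)
  case Nil
  then have "ys = []" by (auto split: if_splits)
  moreover have "\<alpha> = 0" using Nil by (auto simp: nc_counit_def split: if_splits)
  ultimately show ?case by (simp add: zero_composition.rep_eq)
next
  case (Cons x xs)
  show ?case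
  proof (cases ys)
    case Nil
    with Cons.prems show ?thesis by (simp add: lookup_frag_extend split_def)
  next
    case (Cons y zs)
    obtain p where p: "p \<in> Poly_Mapping.keys (nc_coprod (frag_of \<alpha>))"
      "Poly_Mapping.lookup (zp_act hbar (frag_of x) (frag_of (fst p))) y \<noteq> 0"
      "Poly_Mapping.lookup (zpow_act hbar xs (frag_of (snd p))) zs \<noteq> 0"
      using Cons.prems unfolding Cons lookup_zpow_act_Cons
      by (auto elim!: sum.not_neutral_contains_not_neutral split: prod.splits)
    from Cons.IH[OF p(3)] zp_act_degree[OF assms(1), of y x "fst p"] p(2)
      keys_nc_coprod[of "fst p" "snd p" \<alpha>] p(1)
    show ?thesis by (simp add: Cons in_keys_iff)
  qed
qed

lemma zpow_act_singleton:
  fixes xs ys :: "'p::graded_poset list"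
  assumes "pieri_operators hbar" and "length xs = length ys"
  shows "Poly_Mapping.lookup (zpow_act hbar (xs @ x # xs') (frag_of \<alpha>)) (ys @ x # ys') =
    Poly_Mapping.lookup (zpow_act hbar (xs @ xs') (frag_of \<alpha>)) (ys @ ys')"
  using assms(2)
proof (induction xs ys arbitrary: \<alpha> rule: list_induct2)
  case Nil
  let ?K = "Poly_Mapping.keys (nc_coprod (frag_of \<alpha>))"
  have z: "Poly_Mapping.lookup (zp_act hbar (frag_of x) (frag_of \<beta>)) x = (if \<beta> = 0 then 1 else 0)" for \<beta>
  proof (cases "\<beta> = 0")
    case False
    then have "sum_list (parts \<beta>) \<noteq> 0" by (simp only: composition_eq_0_iff not_False_eq_True)
    then show ?thesis using False zp_act_degree[OF assms(1), of x x \<beta>]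
      by (metis add_cancel_right_right in_keys_iff)
  next
    case True
    have "zp_act hbar (frag_of x) (frag_of 0) = frag_of x"
      unfolding zp_act_def frag_extend_of by (simp add: zero_composition.rep_eq)
    then show ?thesis by (simp only: True lookup_frag_of simp_thms if_True)
  qed
  have "Poly_Mapping.lookup (zpow_act hbar (x # xs') (frag_of \<alpha>)) (x # ys') =
    (\<Sum>p \<in> {(0 :: composition, \<alpha>)}. Poly_Mapping.lookup (zpow_act hbar xs' (frag_of \<alpha>)) ys')"
    unfolding lookup_zpow_act_Cons
    by (rule sum.mono_neutral_cong_right)
       (auto simp: z lookup_nc_coprod_0 in_keys_iff split: if_splits)
  then show ?case by simp
qed (simp_all only: append_Cons lookup_zpow_act_Cons)


lemma exponents_nth: "0 \<notin> set l \<Longrightarrow> exponents (Poly_Mapping.nth l) = l"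
proof -
  assume "0 \<notin> set l"
  then have "Poly_Mapping.keys (Poly_Mapping.nth l) = {0..<length l}"
    by (auto simp del: keys_nth simp: in_keys_iff nth.rep_eq nth_default_def split: if_splits) (metis gr0I nth_mem)
  then have "exponents (Poly_Mapping.nth l) = map (Poly_Mapping.lookup (Poly_Mapping.nth l)) [0..<length l]"
    by (simp add: exponents_def)
  also have "\<dots> = l" by (rule nth_equalityI) (simp_all add: nth.rep_eq nth_default_def)
  finally show ?thesis .
qed

lemma zero_notin_exponents: "0 \<notin> set (exponents m)"
  by (auto simp: exponents_def in_keys_iff)

lemma qsym_eqI:
  assumes "\<And>\<alpha>. Mcoeff f \<alpha> = Mcoeff g \<alpha>" shows "f = g"
proof -
  have "mcoeff f m = mcoeff g m" for m
  proof -
    let ?\<alpha> = "composition (exponents m)"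
    have e: "exponents (Poly_Mapping.nth (parts ?\<alpha>)) = exponents m"
      by (simp add: composition_inverse zero_notin_exponents exponents_nth)
    have "quasi_symmetric (mcoeff f)" "quasi_symmetric (mcoeff g)" using mcoeff by auto
    then have "mcoeff f m = Mcoeff f ?\<alpha>" "mcoeff g m = Mcoeff g ?\<alpha>"
      unfolding quasi_symmetric_def Mcoeff_def using e by metis+
    then show ?thesis by (simp add: assms)
  qed
  then show ?thesis by (simp add: mcoeff_inject[symmetric] fun_eq_iff)
qed

lemma qsym_pairing_frag_of [simp]: "qsym_pairing f (frag_of \<alpha>) = Mcoeff f \<alpha>"
  by (simp add: qsym_pairing_def)

lemma K_basis_unique:
  assumes "pieri_operators hbar"
  shows "\<exists>!f. \<forall>\<Psi>. qsym_pairing f \<Psi> = Poly_Mapping.lookup (zpow_act hbar (lower A) \<Psi>) (upper A)"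
proof -
  define F where "F m = Poly_Mapping.lookup (zpow_act hbar (lower A) (frag_of (composition (exponents m)))) (upper A)" for m
  have "quasi_symmetric F" by (simp add: quasi_symmetric_def F_def)
  moreover have "bounded_degree F"
  proof -
    have "sum_list (exponents m) \<le> sum_list (map rk (upper A))" if "F m \<noteq> 0" for m
      using zpow_act_degree[OF assms that[unfolded F_def]]
      by (simp add: composition_inverse zero_notin_exponents)
    then show ?thesis unfolding bounded_degree_def by blast
  qed
  ultimately have M: "Mcoeff (Abs_qsym F) \<alpha> = Poly_Mapping.lookup (zpow_act hbar (lower A) (frag_of \<alpha>)) (upper A)" for \<alpha>
    using parts[of \<alpha>] by (simp add: Mcoeff_def Abs_qsym_inverse F_def exponents_nth parts_inverse)
  show ?thesis
  proof (rule ex1I[of _ "Abs_qsym F"])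
    show "\<forall>\<Psi>. qsym_pairing (Abs_qsym F) \<Psi> = Poly_Mapping.lookup (zpow_act hbar (lower A) \<Psi>) (upper A)"
      by (simp add: qsym_pairing_def M flip: zpow_act_expand)
    show "g = Abs_qsym F" if "\<forall>\<Psi>. qsym_pairing g \<Psi> = Poly_Mapping.lookup (zpow_act hbar (lower A) \<Psi>) (upper A)" for g
      by (rule qsym_eqI) (metis M qsym_pairing_frag_of that)
  qed
qed

lemma qsym_pairing_K_basis:
  assumes "pieri_operators hbar"
  shows "qsym_pairing (K_basis hbar A) \<Psi> = Poly_Mapping.lookup (zpow_act hbar (lower A) \<Psi>) (upper A)"
  using theI'[OF K_basis_unique[OF assms]] unfolding K_basis_def by blast

lemma K_map_of:
  assumes "pieri_operators hbar"
  shows "additive (K_map hbar)" "K_map hbar (hp_of A) = K_basis hbar A"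
proof -
  have Mc: "Mcoeff (K_basis hbar A) \<alpha> = Poly_Mapping.lookup (zpow_act hbar (lower A) (frag_of \<alpha>)) (upper A)" for A \<alpha>
    using qsym_pairing_K_basis[OF assms, of A "frag_of \<alpha>"] by simp
  have "K_basis hbar (A + Intervals [(x, x)] + B) = K_basis hbar (A + B)" for A x B
    by (rule qsym_eqI)
       (simp add: Mc lower_def upper_def plus_intervals_def zpow_act_singleton[OF assms])
  moreover have "K_basis hbar (A + Intervals [(x, y)] + B) = 0" if "\<not> x \<le> y" for A x y B
  proof (rule qsym_eqI)
    fix \<alpha>
    have "Mcoeff (K_basis hbar (A + Intervals [(x, y)] + B)) \<alpha> = 0"
    proof (rule ccontr)
      assume "\<not> ?thesis"
      from zpow_act_degree[OF assms this[unfolded Mc]]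
      have "list_all2 (\<le>) (map fst (factors A) @ x # map fst (factors B)) (map snd (factors A) @ y # map snd (factors B))"
        by (simp add: lower_def upper_def plus_intervals_def)
      then show False using that by (simp add: list_all2_append)
    qed
    then show "Mcoeff (K_basis hbar (A + Intervals [(x, y)] + B)) \<alpha> = Mcoeff 0 \<alpha>"
      by (simp add: Mcoeff_def zero_qsym.rep_eq)
  qed
  ultimately show "additive (K_map hbar)" "K_map hbar (hp_of A) = K_basis hbar A"
    unfolding K_map_def by (blast intro: hp_lift_of)+
qed

end

theory Submission
  imports Defs
begin

text \<open>
  Write \<open>\<langle>x.S\<^sup>\<alpha>, y\<rangle>\<close> for the coefficient of \<open>M\<^sub>\<alpha>\<close> in \<open>K\<^bsub>[x,y]\<^esub>\<close>.  The action on a product of intervals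
  is defined through the coproduct of \<open>NC\<close>, which is dual to the product of \<open>QSym\<close>; hence \<open>K\<close> is
  multiplicative.  Inserting the basis \<open>P\<^sup>k\<close> between \<open>S\<^sup>\<beta>\<close> and \<open>S\<^sup>\<gamma>\<close> in \<open>\<langle>x.S\<^sup>\<beta>S\<^sup>\<gamma>, y\<rangle>\<close> gives
  \<open>\<Sum>\<^sub>z \<langle>x.S\<^sup>\<beta>, z\<rangle> \<langle>z.S\<^sup>\<gamma>, y\<rangle>\<close>, and by the degree condition on Pieri operators only \<open>z \<in> [x,y]\<close>
  contribute; hence \<open>K\<close> is comultiplicative.  Both bialgebras are connected, so their antipodes are
  the locally finite sums of the convolution powers of \<open>\<eta> \<circ> \<epsilon> - id\<close>, and a morphism of bialgebras
  commutes with these powers.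
\<close>


section \<open>Convolution and antipodes\<close>

text \<open>Every tensor is the class of a formal integer combination of pairs, and such
  combinations arise from 0 and generators by differences alone. Identities between linear maps on
  tensors thereby reduce to pure tensors.\<close>

lemma tensor_diff_induct [case_names zero of diff]:
  assumes "P 0" "\<And>a b. P (a \<otimes>\<^sub>t b)" "\<And>s t. P s \<Longrightarrow> P t \<Longrightarrow> P (s - t)"
  shows "P (t :: ('a::ab_group_add, 'b::ab_group_add) tensor)"
proof -
  obtain u :: "'a \<times> 'b \<Rightarrow>\<^sub>0 int" where t: "t = abs_tensor u" by (induction t) auto
  have "P (abs_tensor u)"
    using subset_UNIV
  proof (induction u rule: frag_induction)
    case zero
    then show ?case using assms(1) by (simp add: zero_tensor_def)
  next
    case (one x)
    then show ?case using assms(2) by (cases x) (simp flip: tensor_of.abs_eq)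
  next
    case (diff u v)
    then show ?case using assms(3) by (metis minus_tensor.abs_eq)
  qed
  then show ?thesis by (simp add: t)
qed

lemma additive_compose: "additive f \<Longrightarrow> additive g \<Longrightarrow> additive (\<lambda>x. f (g x))"
  by (simp add: additive_def)

lemma additive_of_int: "additive \<epsilon> \<Longrightarrow> additive (\<lambda>x. of_int (\<epsilon> x))"
  by (simp add: additive_def)

lemma additive_mult:
  fixes f :: "'a::ab_group_add \<Rightarrow> 'c::ring" and g :: "'b::ab_group_add \<Rightarrow> 'c"
  assumes "additive f" "additive g"
  shows "additive (\<lambda>x. f x * g y)" "additive (\<lambda>y. f x * g y)"
  using assms by (simp_all add: additive_def distrib_left distrib_right)

lemma additive_tensor_of: "additive (\<lambda>x. x \<otimes>\<^sub>t y)" "additive (\<lambda>y. x \<otimes>\<^sub>t y)"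
  by (simp_all add: additive_def tensor_of_add_left tensor_of_add_right)

lemma
  assumes "additive f" "additive g"
  shows additive_tensor_map: "additive (tensor_map f g)"
    and tensor_map_of: "tensor_map f g (x \<otimes>\<^sub>t y) = f x \<otimes>\<^sub>t g y"
  unfolding tensor_map_def
  by (rule additive_tensor_lift tensor_lift_of;
      intro additive_compose[OF additive_tensor_of(1)] additive_compose[OF additive_tensor_of(2)] assms)+

lemma additive_of_int_commute:
  fixes f :: "'a::ring_1 \<Rightarrow> 'b::ring_1"
  assumes "additive f" "f 1 = 1"
  shows "f (of_int n) = of_int n"
  by (induction n rule: int_induct[of _ 0])
     (simp_all add: additive.add[OF assms(1)] additive_diff[OF assms(1)] additive_0[OF assms(1)] assms(2))

section \<open>Convolution powers of the unit minus the identity\<close>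

definition conv ::
    "('a::ring_1 \<Rightarrow> ('a, 'a) tensor) \<Rightarrow> ('a \<Rightarrow> 'b::ring_1) \<Rightarrow> ('a \<Rightarrow> 'b) \<Rightarrow> 'a \<Rightarrow> 'b" where
  "conv \<Delta> f g a = tensor_lift (\<lambda>x y. f x * g y) (\<Delta> a)"

lemma
  fixes f :: "'a::ab_group_add \<Rightarrow> 'c::ring" and g :: "'b::ab_group_add \<Rightarrow> 'c"
  assumes "additive f" "additive g"
  shows additive_mult_lift: "additive (tensor_lift (\<lambda>x y. f x * g y))"
    and mult_lift_of: "tensor_lift (\<lambda>x y. f x * g y) (x \<otimes>\<^sub>t y) = f x * g y"
proof -
  note mult = additive_mult(1)[OF assms] additive_mult(2)[OF assms]
  show "additive (tensor_lift (\<lambda>x y. f x * g y))" by (rule additive_tensor_lift) (rule mult)+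
  show "tensor_lift (\<lambda>x y. f x * g y) (x \<otimes>\<^sub>t y) = f x * g y" by (rule tensor_lift_of) (rule mult)+
qed

lemma additive_conv:
  assumes "additive \<Delta>" "additive f" "additive g"
  shows "additive (conv \<Delta> f g)"
  using additive_compose[OF additive_mult_lift[OF assms(2,3)] assms(1)]
  by (simp add: conv_def[abs_def])

text \<open>The identity is the convolution unit minus this map, so the geometric series of its
  convolution powers formally inverts the identity.\<close>

definition coaug :: "('a::ring_1 \<Rightarrow> int) \<Rightarrow> 'a \<Rightarrow> 'a" where
  "coaug \<epsilon> a = of_int (\<epsilon> a) - a"

primrec coaug_pow ::
    "('a::ring_1 \<Rightarrow> ('a, 'a) tensor) \<Rightarrow> ('a \<Rightarrow> int) \<Rightarrow> nat \<Rightarrow> 'a \<Rightarrow> 'a" where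
  "coaug_pow \<Delta> \<epsilon> 0 = (\<lambda>a. of_int (\<epsilon> a))"
| "coaug_pow \<Delta> \<epsilon> (Suc n) = conv \<Delta> (coaug_pow \<Delta> \<epsilon> n) (coaug \<epsilon>)"

lemma additive_coaug: "additive \<epsilon> \<Longrightarrow> additive (coaug \<epsilon>)"
  by (simp add: additive_def coaug_def)

lemma additive_coaug_pow: "additive \<Delta> \<Longrightarrow> additive \<epsilon> \<Longrightarrow> additive (coaug_pow \<Delta> \<epsilon> n)"
  by (induction n) (simp_all add: additive_conv additive_coaug additive_of_int)

text \<open>A multiplicative and comultiplicative map turns a convolution on its source into one on
  its target; induction on \<open>n\<close> passes from \<open>coaug\<close> to its powers.\<close>

lemma coaug_pow_morphism:
  fixes f :: "'a::ring_1 \<Rightarrow> 'b::ring_1"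
  assumes f: "additive f" "f 1 = 1" "\<And>a b. f (a * b) = f a * f b"
    and \<epsilon>: "\<And>a. \<epsilon>\<^sub>B (f a) = \<epsilon>\<^sub>A a" and \<Delta>: "\<And>a. \<Delta>\<^sub>B (f a) = tensor_map f f (\<Delta>\<^sub>A a)"
    and add: "additive \<Delta>\<^sub>A" "additive \<epsilon>\<^sub>A" "additive \<Delta>\<^sub>B" "additive \<epsilon>\<^sub>B"
  shows "f (coaug_pow \<Delta>\<^sub>A \<epsilon>\<^sub>A n a) = coaug_pow \<Delta>\<^sub>B \<epsilon>\<^sub>B n (f a)"
proof -
  note coaugA = additive_coaug[OF add(2)] and coaugB = additive_coaug[OF add(4)]
  note powA = additive_coaug_pow[OF add(1,2)] and powB = additive_coaug_pow[OF add(3,4)]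
  have coaug: "f (coaug \<epsilon>\<^sub>A a) = coaug \<epsilon>\<^sub>B (f a)" for a
    by (simp add: coaug_def additive_diff[OF f(1)] additive_of_int_commute[OF f(1,2)] \<epsilon>)
  show ?thesis
  proof (induction n arbitrary: a)
    case 0
    then show ?case by (simp add: additive_of_int_commute[OF f(1,2)] \<epsilon>)
  next
    case (Suc n)
    note A = powA[of n] coaugA and B = powB[of n] coaugB
    \<comment> \<open>The claim is made for an arbitrary tensor in place of the coproduct of
      \<open>a\<close>, so that pure tensors suffice.\<close>
    have "f (tensor_lift (\<lambda>x y. coaug_pow \<Delta>\<^sub>A \<epsilon>\<^sub>A n x * coaug \<epsilon>\<^sub>A y) t) =
        tensor_lift (\<lambda>x y. coaug_pow \<Delta>\<^sub>B \<epsilon>\<^sub>B n x * coaug \<epsilon>\<^sub>B y) (tensor_map f f t)" for t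
    proof (induction t rule: tensor_diff_induct)
      case zero
      then show ?case
        by (simp add: additive_0[OF additive_mult_lift[OF A]] additive_0[OF additive_mult_lift[OF B]]
              additive_0[OF additive_tensor_map[OF f(1) f(1)]] additive_0[OF f(1)])
    next
      case (of x y)
      then show ?case
        by (simp add: mult_lift_of[OF A] mult_lift_of[OF B] tensor_map_of[OF f(1) f(1)] f(3) Suc.IH coaug)
    next
      case (diff s t)
      then show ?case
        by (simp add: additive_diff[OF additive_mult_lift[OF A]] additive_diff[OF additive_mult_lift[OF B]]
              additive_diff[OF additive_tensor_map[OF f(1) f(1)]] additive_diff[OF f(1)])
    qed
    then show ?case by (simp add: conv_def \<Delta>)
  qed
qed

section \<open>Antipodes as locally finite geometric series\<close>

text \<open>Coassociativity and counitality enter as the monoid laws for convolution of additive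
  endomorphisms, which is the form used by the geometric series and keeps triple tensors out. The
  nilpotency bound may depend on the element.\<close>

locale conilpotent_coalgebra =
  fixes \<Delta> :: "'a::ring_1 \<Rightarrow> ('a, 'a) tensor" and \<epsilon> :: "'a \<Rightarrow> int"
  assumes additive_coprod: "additive \<Delta>" and additive_counit: "additive \<epsilon>"
    and conv_assoc: "\<And>f g h. additive f \<Longrightarrow> additive g \<Longrightarrow> additive h \<Longrightarrow>
      conv \<Delta> (conv \<Delta> f g) h = conv \<Delta> f (conv \<Delta> g (h :: 'a \<Rightarrow> 'a))"
    and conv_unit_left: "\<And>f. additive f \<Longrightarrow> conv \<Delta> (\<lambda>a. of_int (\<epsilon> a)) f = (f :: 'a \<Rightarrow> 'a)"
    and conv_unit_right: "\<And>f. additive f \<Longrightarrow> conv \<Delta> f (\<lambda>a. of_int (\<epsilon> a)) = (f :: 'a \<Rightarrow> 'a)"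
    and coaug_pow_nilpotent: "\<And>a. \<exists>N. \<forall>n\<ge>N. coaug_pow \<Delta> \<epsilon> n a = 0"
begin

abbreviation "J \<equiv> coaug_pow \<Delta> \<epsilon>"

text \<open>Summing over the indices with nonzero term, a finite set by
  \<open>coaug_pow_nilpotent\<close>, requires no choice of a bound for each element.\<close>

definition antipode :: "'a \<Rightarrow> 'a" where
  "antipode a = (\<Sum>n | J n a \<noteq> 0. J n a)"

definition partial :: "nat \<Rightarrow> 'a \<Rightarrow> 'a" where
  "partial N a = (\<Sum>n<N. J n a)"

lemmas additive_coaug_counit = additive_coaug[OF additive_counit]

lemmas additive_J = additive_coaug_pow[OF additive_coprod additive_counit]

lemma additive_partial: "additive (partial N)"
  by (simp add: additive_def partial_def sum.distrib additive.add[OF additive_J])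

lemma antipode_eq_partial:
  assumes "\<forall>n\<ge>N. J n a = 0" shows "antipode a = partial N a"
  unfolding antipode_def partial_def
  by (rule sum.mono_neutral_left) (use assms not_less in auto)

text \<open>The eventual form allows the bounds for several elements to be merged by taking their
  maximum.\<close>

lemma eventually_antipode: "\<exists>N0. \<forall>N\<ge>N0. antipode a = partial N a"
  using coaug_pow_nilpotent[of a] antipode_eq_partial by (meson order_trans)

lemma additive_antipode: "additive antipode"
proof
  fix a b
  obtain L M N where "\<forall>n\<ge>L. antipode a = partial n a" "\<forall>n\<ge>M. antipode b = partial n b"
      "\<forall>n\<ge>N. antipode (a + b) = partial n (a + b)"
    using eventually_antipode by metis
  then have "antipode c = partial (max L (max M N)) c" if "c \<in> {a, b, a + b}" for c
    using that by (metis empty_iff insert_iff max.cobounded1 max.coboundedI2 max.cobounded2)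
  then show "antipode (a + b) = antipode a + antipode b"
    using additive.add[OF additive_partial, of "max L (max M N)" a b] by simp
qed

text \<open>A tensor involves only finitely many pure tensors, so their bounds merge into one. This
  permits replacing the antipode by a partial sum inside a coproduct; \<open>F\<close> stands for
  putting the map on either leg.\<close>

lemma eventually_lift_antipode:
  assumes "\<And>f. additive f \<Longrightarrow> additive (F f)"
    and "\<And>x y. \<exists>N0. \<forall>N\<ge>N0. F antipode (x \<otimes>\<^sub>t y) = F (partial N) (x \<otimes>\<^sub>t y)"
  shows "\<exists>N0. \<forall>N\<ge>N0. F antipode t = (F (partial N) t :: 'a)"
proof (induction t rule: tensor_diff_induct)
  case zero
  then show ?case by (simp add: additive_0 assms(1) additive_antipode additive_partial)
next
  case (of x y)
  then show ?case by (rule assms(2))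
next
  case (diff s t)
  then obtain M N where "\<forall>n\<ge>M. F antipode s = F (partial n) s" "\<forall>n\<ge>N. F antipode t = F (partial n) t"
    by blast
  then show ?case
    by (intro exI[of _ "max M N"]) (auto simp add: additive_diff assms(1) additive_antipode additive_partial)
qed

text \<open>The recursion multiplies on the right; associativity moves the new factor to the left,
  as the second antipode law requires.\<close>

lemma conv_J_commute: "conv \<Delta> (coaug \<epsilon>) (J n) = J (Suc n)"
proof (induction n)
  case 0
  then show ?case by (simp add: conv_unit_left conv_unit_right additive_coaug_counit)
next
  case (Suc n)
  then show ?case by (simp add: conv_assoc[OF additive_coaug_counit additive_J additive_coaug_counit, symmetric])
qed

text \<open>Convolution is bilinear, and the identity is the unit minus
  \<open>coaug \<epsilon>\<close>.\<close>

lemma conv_coaug_left: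
  assumes "additive f"
  shows "conv \<Delta> (\<lambda>a. a) f a = f a - conv \<Delta> (coaug \<epsilon>) f a"
proof -
  have id: "additive (\<lambda>a. a :: 'a)" by (simp add: additive_def)
  have u: "additive (\<lambda>a. of_int (\<epsilon> a) :: 'a)" by (rule additive_of_int[OF additive_counit])
  have "tensor_lift (\<lambda>x y. x * f y) t =
      tensor_lift (\<lambda>x y. of_int (\<epsilon> x) * f y) t - tensor_lift (\<lambda>x y. coaug \<epsilon> x * f y) t" for t
  proof (induction t rule: tensor_diff_induct)
    case (of x y)
    then show ?case
      by (simp only: mult_lift_of id u assms additive_coaug_counit) (simp add: coaug_def left_diff_distrib)
  qed (simp_all add: additive_0[OF additive_mult_lift] additive_diff[OF additive_mult_lift] id u assms additive_coaug_counit)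
  then show ?thesis using fun_cong[OF conv_unit_left[OF assms], of a] by (simp add: conv_def)
qed

lemma conv_coaug_right:
  assumes "additive f"
  shows "conv \<Delta> f (\<lambda>a. a) a = f a - conv \<Delta> f (coaug \<epsilon>) a"
proof -
  have id: "additive (\<lambda>a. a :: 'a)" by (simp add: additive_def)
  have u: "additive (\<lambda>a. of_int (\<epsilon> a) :: 'a)" by (rule additive_of_int[OF additive_counit])
  have "tensor_lift (\<lambda>x y. f x * y) t =
      tensor_lift (\<lambda>x y. f x * of_int (\<epsilon> y)) t - tensor_lift (\<lambda>x y. f x * coaug \<epsilon> y) t" for t
  proof (induction t rule: tensor_diff_induct)
    case (of x y)
    then show ?case
      by (simp only: mult_lift_of id u assms additive_coaug_counit) (simp add: coaug_def right_diff_distrib)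
  qed (simp_all add: additive_0[OF additive_mult_lift] additive_diff[OF additive_mult_lift] id u assms additive_coaug_counit)
  then show ?thesis using fun_cong[OF conv_unit_right[OF assms], of a] by (simp add: conv_def)
qed

text \<open>The truncated geometric series: the sum of the first \<open>N\<close> powers times (unit
  minus \<open>coaug \<epsilon>\<close>) telescopes to the unit minus the \<open>N\<close>-th
  power.\<close>

lemma conv_partial_left: "conv \<Delta> (partial N) (\<lambda>a. a) a = of_int (\<epsilon> a) - J N a"
proof -
  have "conv \<Delta> (partial N) (coaug \<epsilon>) a = (\<Sum>n<N. J (Suc n) a)"
  proof -
    have "tensor_lift (\<lambda>x y. partial N x * coaug \<epsilon> y) t = (\<Sum>n<N. tensor_lift (\<lambda>x y. J n x * coaug \<epsilon> y) t)" for t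
    proof (induction t rule: tensor_diff_induct)
      case (of x y)
      then show ?case
        by (simp only: mult_lift_of additive_coaug_counit additive_J additive_partial) (simp add: partial_def sum_distrib_right)
    qed (simp_all add: additive_0[OF additive_mult_lift] additive_diff[OF additive_mult_lift]
          additive_coaug_counit additive_J additive_partial sum_subtractf)
    then show ?thesis by (simp add: conv_def)
  qed
  then have "conv \<Delta> (partial N) (\<lambda>a. a) a = (\<Sum>n<N. J n a - J (Suc n) a)"
    by (simp add: conv_coaug_right additive_partial partial_def sum_subtractf del: coaug_pow.simps)
  also have "\<dots> = J 0 a - J N a" by (rule sum_lessThan_telescope')
  finally show ?thesis by simp
qed

lemma conv_partial_right: "conv \<Delta> (\<lambda>a. a) (partial N) a = of_int (\<epsilon> a) - J N a"
proof -
  have "conv \<Delta> (coaug \<epsilon>) (partial N) a = (\<Sum>n<N. J (Suc n) a)"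
  proof -
    have "tensor_lift (\<lambda>x y. coaug \<epsilon> x * partial N y) t = (\<Sum>n<N. tensor_lift (\<lambda>x y. coaug \<epsilon> x * J n y) t)" for t
    proof (induction t rule: tensor_diff_induct)
      case (of x y)
      then show ?case
        by (simp only: mult_lift_of additive_coaug_counit additive_J additive_partial) (simp add: partial_def sum_distrib_left)
    qed (simp_all add: additive_0[OF additive_mult_lift] additive_diff[OF additive_mult_lift]
          additive_coaug_counit additive_J additive_partial sum_subtractf)
    then show ?thesis by (simp add: conv_def conv_J_commute[symmetric] del: coaug_pow.simps)
  qed
  then have "conv \<Delta> (\<lambda>a. a) (partial N) a = (\<Sum>n<N. J n a - J (Suc n) a)"
    by (simp add: conv_coaug_left additive_partial partial_def sum_subtractf del: coaug_pow.simps)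
  also have "\<dots> = J 0 a - J N a" by (rule sum_lessThan_telescope')
  finally show ?thesis by simp
qed

lemma is_antipode: "is_antipode \<Delta> \<epsilon> antipode"
  unfolding is_antipode_def
proof (intro conjI allI additive_antipode)
  have id: "additive (\<lambda>a. a :: 'a)" by (simp add: additive_def)
  fix a
  obtain N where N: "\<forall>n\<ge>N. J n a = 0" using coaug_pow_nilpotent by blast
  have "\<exists>N0. \<forall>N\<ge>N0. tensor_lift (\<lambda>x y. antipode x * y) (\<Delta> a) = tensor_lift (\<lambda>x y. partial N x * y) (\<Delta> a)"
  proof (rule eventually_lift_antipode)
    show "additive (tensor_lift (\<lambda>x y. f x * y))" if "additive f" for f :: "'a \<Rightarrow> 'a"
      by (rule additive_mult_lift[OF that id])
    show "\<exists>N0. \<forall>N\<ge>N0. tensor_lift (\<lambda>x y. antipode x * y) (x \<otimes>\<^sub>t y) =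
        tensor_lift (\<lambda>x y. partial N x * y) (x \<otimes>\<^sub>t y)" for x y
      using eventually_antipode[of x]
      by (simp only: mult_lift_of[OF additive_antipode id] mult_lift_of[OF additive_partial id]) metis
  qed
  then obtain M where "\<forall>n\<ge>M. tensor_lift (\<lambda>x y. antipode x * y) (\<Delta> a) = conv \<Delta> (partial n) (\<lambda>a. a) a"
    unfolding conv_def by blast
  \<comment> \<open>At the index \<open>max M N\<close> the partial sum stands for the antipode and
    the remainder \<open>J (max M N) a\<close> vanishes.\<close>
  then show "tensor_lift (\<lambda>x y. antipode x * y) (\<Delta> a) = of_int (\<epsilon> a)"
    using N conv_partial_left[of "max M N" a]
    by (metis diff_zero max.cobounded1 max.cobounded2)
  have "\<exists>N0. \<forall>N\<ge>N0. tensor_lift (\<lambda>x y. x * antipode y) (\<Delta> a) = tensor_lift (\<lambda>x y. x * partial N y) (\<Delta> a)"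
  proof (rule eventually_lift_antipode)
    show "additive (tensor_lift (\<lambda>x y. x * f y))" if "additive f" for f :: "'a \<Rightarrow> 'a"
      by (rule additive_mult_lift[OF id that])
    show "\<exists>N0. \<forall>N\<ge>N0. tensor_lift (\<lambda>x y. x * antipode y) (x \<otimes>\<^sub>t y) =
        tensor_lift (\<lambda>x y. x * partial N y) (x \<otimes>\<^sub>t y)" for x y
      using eventually_antipode[of y]
      by (simp only: mult_lift_of[OF id additive_antipode] mult_lift_of[OF id additive_partial]) metis
  qed
  then obtain M where "\<forall>n\<ge>M. tensor_lift (\<lambda>x y. x * antipode y) (\<Delta> a) = conv \<Delta> (\<lambda>a. a) (partial n) a"
    unfolding conv_def by blast
  then show "tensor_lift (\<lambda>x y. x * antipode y) (\<Delta> a) = of_int (\<epsilon> a)"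
    using N conv_partial_right[of "max M N" a]
    by (metis diff_zero max.cobounded1 max.cobounded2)
qed

end

section \<open>From bialgebra morphisms to Hopf morphisms\<close>

text \<open>Since \<open>f\<close> maps each partial sum of the first series to the corresponding
  one of the second, it maps antipode to antipode: at a common large index both partial sums have
  reached their limits.\<close>

lemma conilpotent_hopf_morphismI:
  fixes f :: "'a::ring_1 \<Rightarrow> 'b::ring_1"
  assumes A: "conilpotent_coalgebra \<Delta>\<^sub>A \<epsilon>\<^sub>A" and B: "conilpotent_coalgebra \<Delta>\<^sub>B \<epsilon>\<^sub>B"
    and f: "additive f" "f 1 = 1" "\<And>a b. f (a * b) = f a * f b"
    and \<epsilon>: "\<And>a. \<epsilon>\<^sub>B (f a) = \<epsilon>\<^sub>A a" and \<Delta>: "\<And>a. \<Delta>\<^sub>B (f a) = tensor_map f f (\<Delta>\<^sub>A a)"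
  shows "hopf_morphism \<Delta>\<^sub>A \<epsilon>\<^sub>A \<Delta>\<^sub>B \<epsilon>\<^sub>B f"
proof -
  interpret A: conilpotent_coalgebra \<Delta>\<^sub>A \<epsilon>\<^sub>A by (rule A)
  interpret B: conilpotent_coalgebra \<Delta>\<^sub>B \<epsilon>\<^sub>B by (rule B)
  have "f (A.antipode a) = B.antipode (f a)" for a
  proof -
    obtain M N where M: "\<forall>n\<ge>M. A.antipode a = A.partial n a" and N: "\<forall>n\<ge>N. B.antipode (f a) = B.partial n (f a)"
      using A.eventually_antipode B.eventually_antipode by metis
    let ?n = "max M N"
    have "f (A.partial ?n a) = (\<Sum>n<?n. f (A.J n a))"
      unfolding A.partial_def by (rule additive.sum[OF f(1)])
    also have "\<dots> = B.partial ?n (f a)"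
      by (simp add: B.partial_def A.additive_coprod A.additive_counit B.additive_coprod B.additive_counit
            coaug_pow_morphism[where f = f and \<Delta>\<^sub>A = \<Delta>\<^sub>A and \<Delta>\<^sub>B = \<Delta>\<^sub>B and \<epsilon>\<^sub>A = \<epsilon>\<^sub>A and \<epsilon>\<^sub>B = \<epsilon>\<^sub>B, OF f \<epsilon> \<Delta>])
    finally show ?thesis using M N by (metis max.cobounded1 max.cobounded2)
  qed
  then show ?thesis
    unfolding hopf_morphism_def using f \<epsilon> \<Delta> A.is_antipode B.is_antipode by blast
qed


section \<open>The coalgebra of intervals\<close>

lemma hp_diff_induct [case_names zero of diff]:
  assumes "P 0" "\<And>A. P (hp_of A)" "\<And>s t. P s \<Longrightarrow> P t \<Longrightarrow> P (s - t)"
  shows "P (t :: 'p::graded_poset hp)"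
proof -
  obtain u :: "'p intervals \<Rightarrow>\<^sub>0 int" where t: "t = abs_hp u" by (induction t) auto
  have "P (abs_hp u)"
    using subset_UNIV
  proof (induction u rule: frag_induction)
    case zero
    then show ?case using assms(1) by (simp add: zero_hp_def)
  next
    case (one x)
    then show ?case using assms(2) by (simp flip: hp_of.abs_eq)
  next
    case (diff u v)
    then show ?case using assms(3) by (metis minus_hp.abs_eq)
  qed
  then show ?thesis by (simp add: t)
qed

lemma additive_hp_ext:
  assumes "additive \<phi>" "additive \<psi>" "\<And>A. \<phi> (hp_of A) = \<psi> (hp_of A)"
  shows "\<phi> = \<psi>"
proof
  show "\<phi> a = \<psi> a" for a
    by (induction a rule: hp_diff_induct)
       (simp_all add: assms(3) additive_0[OF assms(1)] additive_0[OF assms(2)]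
         additive_diff[OF assms(1)] additive_diff[OF assms(2)])
qed

lemma hp_of_add: "hp_of (A + B) = hp_of A * hp_of B"
  by transfer (simp add: mult_single hp_rel.zero)

lemma hp_of_0: "hp_of 0 = 1"
  by transfer (simp add: hp_rel.zero)

text \<open>Membership is expressed by the componentwise order on lists, so that chains in a power
  of P can be manipulated by transitivity.\<close>

lemma elements_iff:
  "zs \<in> elements A \<longleftrightarrow> list_all2 (\<le>) (lower A) zs \<and> list_all2 (\<le>) zs (upper A)"
  by (auto simp: elements_def lower_def upper_def list_all2_conv_all_nth split_def)

lemma length_lower_upper: "length (lower A) = length (upper A)"
  by (simp add: lower_def upper_def)

lemma interval_lower_upper: "interval (lower A) (upper A) = A"
  by (cases A) (simp add: interval_def lower_def upper_def zip_map_fst_snd)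

lemma lower_interval: "length xs = length ys \<Longrightarrow> lower (interval xs ys) = xs"
  and upper_interval: "length xs = length ys \<Longrightarrow> upper (interval xs ys) = ys"
  by (simp_all add: interval_def lower_def upper_def)

lemma finite_elements: "finite (elements (A :: 'p::graded_poset intervals))"
proof -
  let ?S = "\<Union>(x, y) \<in> set (factors A). {z. x \<le> z \<and> z \<le> y}"
  have "elements A \<subseteq> {zs. set zs \<subseteq> ?S \<and> length zs = length (factors A)}"
  proof (intro subsetI CollectI conjI)
    fix zs z assume zs: "zs \<in> elements A"
    then show "length zs = length (factors A)"
      by (simp add: elements_def list_all2_lengthD)
    assume "z \<in> set zs"
    with zs show "z \<in> ?S"
      by (force simp: elements_def list_all2_conv_all_nth in_set_conv_nth)
  qed
  moreover have "finite \<dots>"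
    by (rule finite_lists_length_eq) (auto simp: finite_interval)
  ultimately show ?thesis by (rule finite_subset)
qed

section \<open>Convolution on intervals as an incidence algebra\<close>

text \<open>Read as functions of the two end points, linear maps on HP convolve as in the incidence
  algebra of a power of P.\<close>

lemma conv_hp_of:
  fixes f g :: "'p::graded_poset hp \<Rightarrow> 'b::ring_1"
  assumes "additive f" "additive g"
  shows "conv hp_coprod f g (hp_of A) =
    (\<Sum>zs \<in> elements A. f (hp_of (interval (lower A) zs)) * g (hp_of (interval zs (upper A))))"
  unfolding conv_def hp_coprod_of(2)
  by (simp add: additive.sum[OF additive_mult_lift[OF assms]] mult_lift_of[OF assms])

lemma hp_of_diag: "hp_of (interval xs xs) = 1"
proof (induction xs)
  case Nil
  then show ?case by (simp add: interval_def hp_of_0 flip: zero_intervals_def)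
next
  case (Cons x xs)
  have "interval (x # xs) (x # xs) = 0 + Intervals [(x, x)] + interval xs xs"
    by (simp add: interval_def plus_intervals_def zero_intervals_def)
  then show ?case using Cons by (simp only: hp_of_singleton) simp
qed

lemma list_all2_le_refl: "list_all2 (\<le>) xs (xs :: 'p::order list)"
  by (simp add: list_all2_same)

lemma list_all2_le_trans:
  "list_all2 (\<le>) xs ys \<Longrightarrow> list_all2 (\<le>) ys zs \<Longrightarrow> list_all2 (\<le>) xs (zs :: 'p::order list)"
  by (rule list_all2_trans[OF order_trans])

lemma rk_mono: "x \<le> y \<Longrightarrow> rk x \<le> rk (y :: 'p::graded_poset)"
  using rk_less[of x y] by (auto simp: order_le_less)

lemma sum_list_rk_mono:
  "list_all2 (\<le>) xs ys \<Longrightarrow> sum_list (map rk xs) \<le> sum_list (map rk (ys :: 'p::graded_poset list))"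
  by (induction rule: list_all2_induct) (auto intro: add_mono rk_mono)

text \<open>No component can lose rank, so equal totals force equal ranks componentwise, and rank is
  strictly increasing.\<close>

lemma sum_list_rk_eq:
  "list_all2 (\<le>) xs ys \<Longrightarrow> sum_list (map rk ys) = sum_list (map rk xs) \<Longrightarrow>
     xs = (ys :: 'p::graded_poset list)"
proof (induction rule: list_all2_induct)
  case (Cons x xs y ys)
  have "rk x \<le> rk y" "sum_list (map rk xs) \<le> sum_list (map rk ys)"
    using Cons sum_list_rk_mono rk_mono by auto
  with Cons rk_less[of x y] show ?case by (auto simp: order_le_less)
qed simp

text \<open>The counit is the delta function of the incidence algebra: a nonempty product of degree
  0 has equal end points.\<close>

lemma counit_interval:
  assumes "list_all2 (\<le>) xs ys"
  shows "hp_counit (hp_of (interval xs ys)) = (if xs = ys then 1 else 0)"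
proof -
  have "sum_list (map rk ys) = sum_list (map rk xs) + degree (interval xs ys) \<and>
      nonempty_intervals (interval xs ys)"
    using assms
  proof (induction rule: list_all2_induct)
    case (Cons x xs y ys)
    then show ?case using rk_mono[of x y] by (simp add: degree_def interval_def nonempty_intervals_def)
  qed (simp add: degree_def interval_def nonempty_intervals_def)
  moreover have "xs = ys \<longleftrightarrow> sum_list (map rk ys) = sum_list (map rk xs)"
    using sum_list_rk_eq[OF assms] by auto
  ultimately show ?thesis by (simp add: hp_counit_of counit_basis_def)
qed

lemma hp_of_eq_0:
  assumes "length xs = length ys" "\<not> list_all2 (\<le>) xs ys"
  shows "hp_of (interval xs ys) = 0"
proof -
  obtain i where i: "i < length xs" "\<not> xs ! i \<le> ys ! i"
    using assms by (auto simp: list_all2_conv_all_nth)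
  let ?z = "zip xs ys"
  have "interval xs ys = Intervals (take i ?z) + Intervals [(xs ! i, ys ! i)] + Intervals (drop (Suc i) ?z)"
    using i(1) assms(1) id_take_nth_drop[of i ?z] by (simp add: interval_def plus_intervals_def)
  then show ?thesis using hp_of_empty[OF i(2)] by simp
qed

text \<open>Both sides sum over chains of two intermediate elements \<open>us\<close> below
  \<open>zs\<close>; they differ only in which one is chosen first.\<close>

lemma conv_hp_assoc:
  fixes f g h :: "'p::graded_poset hp \<Rightarrow> 'b::ring_1"
  assumes "additive f" "additive g" "additive h"
  shows "conv hp_coprod (conv hp_coprod f g) h = conv hp_coprod f (conv hp_coprod g h)"
proof (rule additive_hp_ext)
  note add = assms additive_conv hp_coprod_of(1)
  show "additive (conv hp_coprod (conv hp_coprod f g) h)" "additive (conv hp_coprod f (conv hp_coprod g h))"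
    by (simp_all add: add)
  fix A :: "'p intervals"
  let ?F = "\<lambda>zs. f (hp_of (interval (lower A) zs))" and ?G = "\<lambda>us zs. g (hp_of (interval us zs))"
    and ?H = "\<lambda>zs. h (hp_of (interval zs (upper A)))"
  have 1: "length zs = length (lower A)" "length zs = length (upper A)" if "zs \<in> elements A" for zs
    using that length_lower_upper[of A] by (auto simp: elements_iff dest: list_all2_lengthD)
  have swap1: "us \<in> elements A \<and> zs \<in> elements (interval us (upper A))"
    if "zs \<in> elements A" "us \<in> elements (interval (lower A) zs)" for us zs
  proof -
    from that 1[OF that(1)] have us: "list_all2 (\<le>) (lower A) us" "list_all2 (\<le>) us zs"
        and zs: "list_all2 (\<le>) zs (upper A)"
      by (simp_all add: elements_iff lower_interval upper_interval)
    with list_all2_le_trans[OF us(2) zs] list_all2_lengthD[OF us(2)] 1[OF that(1)] show ?thesis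
      by (simp add: elements_iff lower_interval upper_interval)
  qed
  have swap2: "zs \<in> elements A \<and> us \<in> elements (interval (lower A) zs)"
    if "us \<in> elements A" "zs \<in> elements (interval us (upper A))" for us zs
  proof -
    from that 1[OF that(1)] have zs: "list_all2 (\<le>) us zs" "list_all2 (\<le>) zs (upper A)"
        and us: "list_all2 (\<le>) (lower A) us"
      by (simp_all add: elements_iff lower_interval upper_interval)
    with list_all2_le_trans[OF us zs(1)] list_all2_lengthD[OF zs(1)] 1[OF that(1)] show ?thesis
      by (simp add: elements_iff lower_interval upper_interval)
  qed
  have "conv hp_coprod (conv hp_coprod f g) h (hp_of A) =
      (\<Sum>zs \<in> elements A. \<Sum>us \<in> elements (interval (lower A) zs). ?F us * ?G us zs * ?H zs)"
    by (simp add: conv_hp_of add sum_distrib_right 1 lower_interval upper_interval cong: sum.cong)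
  also have "\<dots> = (\<Sum>us \<in> elements A. \<Sum>zs \<in> elements (interval us (upper A)). ?F us * ?G us zs * ?H zs)"
  proof -
    have "(\<Sum>p \<in> Sigma (elements A) (\<lambda>zs. elements (interval (lower A) zs)). ?F (snd p) * ?G (snd p) (fst p) * ?H (fst p)) =
      (\<Sum>p \<in> Sigma (elements A) (\<lambda>us. elements (interval us (upper A))). ?F (fst p) * ?G (fst p) (snd p) * ?H (snd p))"
      by (rule sum.reindex_bij_witness[of _ prod.swap prod.swap]) (auto dest: swap1 swap2)
    then show ?thesis
      by (subst (1 2) sum.Sigma) (simp_all add: finite_elements split_def)
  qed
  also have "\<dots> = conv hp_coprod f (conv hp_coprod g h) (hp_of A)"
    by (simp add: conv_hp_of add sum_distrib_left 1 length_lower_upper lower_interval upper_interval mult.assoc cong: sum.cong)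
  finally show "conv hp_coprod (conv hp_coprod f g) h (hp_of A) = conv hp_coprod f (conv hp_coprod g h) (hp_of A)" .
qed

lemma additive_hp_counit: "additive (\<lambda>a :: 'p::graded_poset hp. of_int (hp_counit a) :: 'b::ring_1)"
  by (rule additive_of_int[OF hp_counit_of(1)])

lemma lower_upper_in_elements:
  "list_all2 (\<le>) (lower A) (upper A) \<Longrightarrow> lower A \<in> elements A"
  "list_all2 (\<le>) (lower A) (upper A) \<Longrightarrow> upper A \<in> elements A"
  by (simp_all add: elements_iff list_all2_le_refl)

lemma hp_of_not_le: "\<not> list_all2 (\<le>) (lower A) (upper A) \<Longrightarrow> hp_of A = 0"
  using hp_of_eq_0[OF length_lower_upper, of A] by (simp add: interval_lower_upper)

text \<open>As the counit is a delta function, only the summand at one end point survives. A product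
  with an empty factor is 0 in HP and is treated separately.\<close>

lemma conv_hp_unit:
  fixes f :: "'p::graded_poset hp \<Rightarrow> 'b::ring_1"
  assumes "additive f"
  shows "conv hp_coprod (\<lambda>a. of_int (hp_counit a)) f = f"
    and "conv hp_coprod f (\<lambda>a. of_int (hp_counit a)) = f"
proof -
  note add = assms additive_conv hp_coprod_of(1) additive_hp_counit
  show "conv hp_coprod (\<lambda>a. of_int (hp_counit a)) f = f"
  proof (rule additive_hp_ext)
    fix A :: "'p intervals"
    show "conv hp_coprod (\<lambda>a. of_int (hp_counit a)) f (hp_of A) = f (hp_of A)"
    proof (cases "list_all2 (\<le>) (lower A) (upper A)")
      case True
      have "conv hp_coprod (\<lambda>a. of_int (hp_counit a)) f (hp_of A) =
          (\<Sum>zs \<in> elements A. if lower A = zs then f (hp_of A) else 0)"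
        unfolding conv_hp_of[OF additive_hp_counit assms]
        by (rule sum.cong) (auto simp: elements_iff counit_interval interval_lower_upper)
      then show ?thesis using True by (simp add: finite_elements lower_upper_in_elements)
    next
      case False
      then have "hp_of A = 0" by (rule hp_of_not_le)
      then show ?thesis using additive_0[of "conv hp_coprod (\<lambda>a. of_int (hp_counit a)) f"]
        by (simp add: add additive_0[OF assms])
    qed
  qed (simp_all add: add)
  show "conv hp_coprod f (\<lambda>a. of_int (hp_counit a)) = f"
  proof (rule additive_hp_ext)
    fix A :: "'p intervals"
    show "conv hp_coprod f (\<lambda>a. of_int (hp_counit a)) (hp_of A) = f (hp_of A)"
    proof (cases "list_all2 (\<le>) (lower A) (upper A)")
      case True
      have "conv hp_coprod f (\<lambda>a. of_int (hp_counit a)) (hp_of A) =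
          (\<Sum>zs \<in> elements A. if zs = upper A then f (hp_of A) else 0)"
        unfolding conv_hp_of[OF assms additive_hp_counit]
        by (rule sum.cong) (auto simp: elements_iff counit_interval interval_lower_upper)
      then show ?thesis using True by (simp add: finite_elements lower_upper_in_elements)
    next
      case False
      then have "hp_of A = 0" by (rule hp_of_not_le)
      then show ?thesis using additive_0[of "conv hp_coprod f (\<lambda>a. of_int (hp_counit a))"]
        by (simp add: add additive_0[OF assms])
    qed
  qed (simp_all add: add)
qed

text \<open>Since \<open>coaug\<close> kills singleton intervals, the \<open>n\<close>-th power sums
  over chains with \<open>n\<close> strict steps. Each step raises the rank by at least 1, so no
  chain fits when the rank difference is below \<open>n\<close>.\<close>

lemma coaug_pow_hp_of:
  fixes xs ys :: "'p::graded_poset list"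
  assumes "list_all2 (\<le>) xs ys" "sum_list (map rk ys) < sum_list (map rk xs) + n"
  shows "coaug_pow hp_coprod hp_counit n (hp_of (interval xs ys)) = 0"
  using assms
proof (induction n arbitrary: ys)
  case 0
  then show ?case using sum_list_rk_mono[of xs ys] by simp
next
  case (Suc n)
  have len: "length xs = length ys" using Suc.prems(1) by (rule list_all2_lengthD)
  have "coaug_pow hp_coprod hp_counit n (hp_of (interval xs zs)) * coaug hp_counit (hp_of (interval zs ys)) = 0"
    if "list_all2 (\<le>) xs zs" "list_all2 (\<le>) zs ys" for zs
  proof (cases "zs = ys")
    case True
    then show ?thesis using counit_interval[OF list_all2_le_refl[of ys]] by (simp add: coaug_def hp_of_diag)
  next
    case False
    then have "sum_list (map rk zs) < sum_list (map rk ys)"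
      using sum_list_rk_eq[OF that(2)] sum_list_rk_mono[OF that(2)] by fastforce
    then show ?thesis using Suc.IH[OF that(1)] Suc.prems(2) by simp
  qed
  then show ?case
    by (simp add: conv_hp_of additive_coaug_pow additive_coaug hp_coprod_of(1) hp_counit_of(1)
          lower_interval upper_interval len elements_iff)
qed

lemma conilpotent_hp: "conilpotent_coalgebra (hp_coprod :: 'p::graded_poset hp \<Rightarrow> _) hp_counit"
proof
  fix x y :: "'p hp"
  show "hp_coprod (x + y) = hp_coprod x + hp_coprod y" by (rule additive.add[OF hp_coprod_of(1)])
  show "hp_counit (x + y) = hp_counit x + hp_counit y" by (rule additive.add[OF hp_counit_of(1)])
next
  fix a :: "'p hp"
  let ?J = "coaug_pow (hp_coprod :: 'p hp \<Rightarrow> _) hp_counit"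
  have add: "additive (?J n)" for n by (rule additive_coaug_pow[OF hp_coprod_of(1) hp_counit_of(1)])
  show "\<exists>N. \<forall>n\<ge>N. ?J n a = 0"
  proof (induction a rule: hp_diff_induct)
    case zero
    then show ?case by (simp add: additive_0[OF add])
  next
    case (of A)
    show ?case
    proof (cases "list_all2 (\<le>) (lower A) (upper A)")
      case True
      \<comment> \<open>Ranks are natural numbers, so the rank of the upper end point alone bounds
        the length of a strict chain.\<close>
      show ?thesis
        using coaug_pow_hp_of[OF True]
        by (intro exI[of _ "Suc (sum_list (map rk (upper A)))"]) (auto simp: interval_lower_upper)
    next
      case False
      then have "hp_of A = 0" by (rule hp_of_not_le)
      then show ?thesis by (simp add: additive_0[OF add])
    qed
  next
    case (diff s t)
    then obtain M N where "\<forall>n\<ge>M. ?J n s = 0" "\<forall>n\<ge>N. ?J n t = 0" by blast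
    then show ?case by (intro exI[of _ "max M N"]) (auto simp: additive_diff[OF add])
  qed
qed (simp_all only: conv_hp_assoc conv_hp_unit)


section \<open>The coalgebra of quasi-symmetric functions\<close>

definition compositions_upto :: "nat \<Rightarrow> composition set" where
  "compositions_upto d = {\<alpha>. sum_list (parts \<alpha>) \<le> d}"

text \<open>Parts are positive, so the degree bounds the number of parts as well as their
  size.\<close>

lemma finite_compositions_upto: "finite (compositions_upto d)"
proof (rule finite_imageD)
  have len: "length l \<le> sum_list l" if "0 \<notin> set l" for l :: "nat list"
    using that by (induction l) (auto simp: Suc_le_eq intro: add_less_le_mono)
  have "parts ` compositions_upto d \<subseteq> {l. set l \<subseteq> {..d} \<and> length l \<le> d}"
  proof (intro image_subsetI CollectI conjI subsetI)
    fix \<alpha> assume \<alpha>: "\<alpha> \<in> compositions_upto d"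
    show "length (parts \<alpha>) \<le> d"
      using len[of "parts \<alpha>"] parts[of \<alpha>] \<alpha> by (simp add: compositions_upto_def)
    show "k \<in> {..d}" if "k \<in> set (parts \<alpha>)" for k
      using member_le_sum_list[OF that] \<alpha> by (simp add: compositions_upto_def)
  qed
  then show "finite (parts ` compositions_upto d)"
    by (rule finite_subset) (simp add: finite_lists_length_le)
  show "inj_on parts (compositions_upto d)" by (simp add: inj_on_def parts_inject)
qed

lemma sum_list_parts_add: "sum_list (parts (\<beta> + \<gamma>)) = sum_list (parts \<beta>) + sum_list (parts \<gamma>)"
  by (simp add: plus_composition.rep_eq)

definition splits :: "composition \<Rightarrow> (composition \<times> composition) set" where
  "splits \<alpha> = {(\<beta>, \<gamma>). \<beta> + \<gamma> = \<alpha>}"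

lemma finite_splits: "finite (splits \<alpha>)"
proof (rule finite_subset)
  let ?C = "compositions_upto (sum_list (parts \<alpha>))"
  show "splits \<alpha> \<subseteq> ?C \<times> ?C"
    by (auto simp: splits_def compositions_upto_def sum_list_parts_add)
  show "finite (?C \<times> ?C)" by (simp add: finite_compositions_upto)
qed

lemma additive_Mcoeff: "additive (\<lambda>f. Mcoeff f \<alpha>)"
  by (simp add: additive_def Mcoeff_def plus_qsym.rep_eq)

lemma additive_of_int_mult:
  fixes \<phi> :: "'a::ring_1 \<Rightarrow> 'b::ring_1"
  assumes "additive \<phi>"
  shows "\<phi> (of_int n * x) = of_int n * \<phi> x"
  by (induction n rule: int_induct[of _ 0])
     (simp_all add: additive_0[OF assms] additive.add[OF assms] additive_diff[OF assms] distrib_right left_diff_distrib)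

lemma Mcoeff_Mbasis: "Mcoeff (Mbasis \<alpha>) \<beta> = (if \<alpha> = \<beta> then 1 else 0)"
  using parts[of \<beta>] by (auto simp: Mcoeff_def Mbasis.rep_eq exponents_nth parts_inject)

lemma Mcoeff_of_int_mult: "Mcoeff (of_int n * f) \<alpha> = n * Mcoeff f \<alpha>"
  using additive_of_int_mult[OF additive_Mcoeff, of n f] by simp

lemma Mcoeff_degree: "\<exists>d. \<forall>\<alpha>. Mcoeff f \<alpha> \<noteq> 0 \<longrightarrow> \<alpha> \<in> compositions_upto d"
proof -
  obtain d where "\<And>m. mcoeff f m \<noteq> 0 \<Longrightarrow> sum_list (exponents m) \<le> d"
    using mcoeff[of f] by (auto simp: bounded_degree_def)
  then have "\<forall>\<alpha>. Mcoeff f \<alpha> \<noteq> 0 \<longrightarrow> \<alpha> \<in> compositions_upto d"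
    using exponents_nth parts unfolding Mcoeff_def compositions_upto_def by fastforce
  then show ?thesis ..
qed

text \<open>Any finite set containing the support is allowed, so that several functions can be
  expanded over one index set.\<close>

lemma qsym_expand:
  assumes "finite S" "\<And>\<alpha>. Mcoeff f \<alpha> \<noteq> 0 \<Longrightarrow> \<alpha> \<in> S"
  shows "f = (\<Sum>\<alpha>\<in>S. of_int (Mcoeff f \<alpha>) * Mbasis \<alpha>)"
proof (rule qsym_eqI)
  fix \<beta>
  have "Mcoeff (\<Sum>\<alpha>\<in>S. of_int (Mcoeff f \<alpha>) * Mbasis \<alpha>) \<beta> =
      (\<Sum>\<alpha>\<in>S. if \<alpha> = \<beta> then Mcoeff f \<beta> else 0)"
    by (subst additive.sum[OF additive_Mcoeff])
       (auto simp: Mcoeff_of_int_mult Mcoeff_Mbasis intro!: sum.cong)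
  then show "Mcoeff f \<beta> = Mcoeff (\<Sum>\<alpha>\<in>S. of_int (Mcoeff f \<alpha>) * Mbasis \<alpha>) \<beta>"
    using assms by auto
qed

text \<open>Bounded degree makes the monomial expansion finite, so the monomial functions generate
  QSym as an abelian group.\<close>

lemma qsym_diff_induct [case_names zero Mbasis diff]:
  assumes "P 0" "\<And>\<alpha>. P (Mbasis \<alpha>)" "\<And>f g. P f \<Longrightarrow> P g \<Longrightarrow> P (f - g)"
  shows "P f"
proof -
  have add: "P (f + g)" if "P f" "P g" for f g
    using assms(3)[OF that(1) assms(3)[OF assms(1) that(2)]] by simp
  have mult: "P (of_int n * f)" if "P f" for n f
    by (induction n rule: int_induct[of _ 0]) (simp_all add: assms(1,3) add that distrib_right left_diff_distrib)
  have sum: "P (\<Sum>\<alpha>\<in>S. of_int (c \<alpha>) * Mbasis \<alpha>)" if "finite S" for S c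
    using that by induction (simp_all add: assms(1,2) add mult)
  obtain d where "\<forall>\<alpha>. Mcoeff f \<alpha> \<noteq> 0 \<longrightarrow> \<alpha> \<in> compositions_upto d" using Mcoeff_degree by blast
  then have "f = (\<Sum>\<alpha>\<in>compositions_upto d. of_int (Mcoeff f \<alpha>) * Mbasis \<alpha>)"
    by (intro qsym_expand finite_compositions_upto) blast
  then show ?thesis using sum[OF finite_compositions_upto] by metis
qed

lemma additive_qsym_ext:
  assumes "additive \<phi>" "additive \<psi>" "\<And>\<alpha>. \<phi> (Mbasis \<alpha>) = \<psi> (Mbasis \<alpha>)"
  shows "\<phi> = \<psi>"
proof
  show "\<phi> f = \<psi> f" for f
    by (induction f rule: qsym_diff_induct)
       (simp_all add: assms(3) additive_0[OF assms(1)] additive_0[OF assms(2)]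
         additive_diff[OF assms(1)] additive_diff[OF assms(2)])
qed

section \<open>The deconcatenation coproduct\<close>

text \<open>The definition sums over the support of \<open>f\<close>, which varies with
  \<open>f\<close>; a common larger index set makes additivity a termwise matter.\<close>

lemma qsym_coprod_superset:
  assumes "finite S" "\<And>\<alpha>. Mcoeff f \<alpha> \<noteq> 0 \<Longrightarrow> \<alpha> \<in> S"
  shows "qsym_coprod f =
    (\<Sum>\<alpha>\<in>S. \<Sum>(\<beta>, \<gamma>)\<in>splits \<alpha>. (of_int (Mcoeff f \<alpha>) * Mbasis \<beta>) \<otimes>\<^sub>t Mbasis \<gamma>)"
  unfolding qsym_coprod_def splits_def[symmetric]
  by (rule sum.mono_neutral_left)
     (use assms in \<open>auto simp: additive_0[OF additive_tensor_of(1)] intro!: sum.neutral\<close>)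

lemma qsym_coprod_Mbasis: "qsym_coprod (Mbasis \<alpha>) = (\<Sum>(\<beta>, \<gamma>)\<in>splits \<alpha>. Mbasis \<beta> \<otimes>\<^sub>t Mbasis \<gamma>)"
  using qsym_coprod_superset[of "{\<alpha>}" "Mbasis \<alpha>"] by (simp add: Mcoeff_Mbasis split: if_splits)

lemma additive_qsym_coprod: "additive qsym_coprod"
proof
  fix f g
  obtain d e where d: "\<forall>\<alpha>. Mcoeff f \<alpha> \<noteq> 0 \<longrightarrow> \<alpha> \<in> compositions_upto d"
    and e: "\<forall>\<alpha>. Mcoeff g \<alpha> \<noteq> 0 \<longrightarrow> \<alpha> \<in> compositions_upto e"
    using Mcoeff_degree by metis
  let ?S = "compositions_upto d \<union> compositions_upto e"
  have fin: "finite ?S" by (simp add: finite_compositions_upto)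
  have fg: "\<alpha> \<in> ?S" if "Mcoeff (f + g) \<alpha> \<noteq> 0" for \<alpha>
    using that d e additive.add[OF additive_Mcoeff, of f g \<alpha>] by (cases "Mcoeff f \<alpha> = 0") auto
  have f: "\<alpha> \<in> ?S" if "Mcoeff f \<alpha> \<noteq> 0" for \<alpha> using d that by blast
  have g: "\<alpha> \<in> ?S" if "Mcoeff g \<alpha> \<noteq> 0" for \<alpha> using e that by blast
  have "qsym_coprod h = (\<Sum>\<alpha>\<in>?S. \<Sum>(\<beta>, \<gamma>)\<in>splits \<alpha>. (of_int (Mcoeff h \<alpha>) * Mbasis \<beta>) \<otimes>\<^sub>t Mbasis \<gamma>)"
    if "h \<in> {f, g, f + g}" for h
    by (rule qsym_coprod_superset[OF fin]) (use that f g fg in blast)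
  then show "qsym_coprod (f + g) = qsym_coprod f + qsym_coprod g"
    by (simp add: additive.add[OF additive_Mcoeff] distrib_right tensor_of_add_left sum.distrib split_def)
qed

lemma additive_qsym_counit: "additive qsym_counit"
  unfolding qsym_counit_def[abs_def] by (rule additive_Mcoeff)

lemma qsym_counit_Mbasis: "qsym_counit (Mbasis \<alpha>) = (if \<alpha> = 0 then 1 else 0)"
  by (simp add: qsym_counit_def Mcoeff_Mbasis)

lemma Mbasis_0: "Mbasis 0 = 1"
  by (rule mcoeff_inject[THEN iffD1]) (simp add: Mbasis.rep_eq one_qsym.rep_eq zero_composition.rep_eq)

lemma conv_Mbasis:
  assumes "additive f" "additive g"
  shows "conv qsym_coprod f g (Mbasis \<alpha>) = (\<Sum>(\<beta>, \<gamma>)\<in>splits \<alpha>. f (Mbasis \<beta>) * g (Mbasis \<gamma>))"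
  unfolding conv_def qsym_coprod_Mbasis
  by (simp add: additive.sum[OF additive_mult_lift[OF assms]] mult_lift_of[OF assms] split_def)

text \<open>Both sides sum over the ways to cut \<alpha> into three consecutive pieces.\<close>

lemma conv_qsym_assoc:
  assumes "additive f" "additive g" "additive h"
  shows "conv qsym_coprod (conv qsym_coprod f g) h = conv qsym_coprod f (conv qsym_coprod g h)"
proof (rule additive_qsym_ext)
  note add = assms additive_conv additive_qsym_coprod
  show "additive (conv qsym_coprod (conv qsym_coprod f g) h)" "additive (conv qsym_coprod f (conv qsym_coprod g h))"
    by (simp_all add: add)
  fix \<alpha>
  let ?f = "\<lambda>\<beta>. f (Mbasis \<beta>)" and ?g = "\<lambda>\<beta>. g (Mbasis \<beta>)" and ?h = "\<lambda>\<beta>. h (Mbasis \<beta>)"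
  have "conv qsym_coprod (conv qsym_coprod f g) h (Mbasis \<alpha>) =
      (\<Sum>(p, q) \<in> Sigma (splits \<alpha>) (\<lambda>p. splits (fst p)). ?f (fst q) * ?g (snd q) * ?h (snd p))"
    by (subst sum.Sigma[symmetric]) (auto simp: conv_Mbasis add finite_splits sum_distrib_right split_def)
  also have "\<dots> = (\<Sum>(p, q) \<in> Sigma (splits \<alpha>) (\<lambda>p. splits (snd p)). ?f (fst p) * (?g (fst q) * ?h (snd q)))"
    \<comment> \<open>A cut into \<beta>, \<gamma>, \<delta> appears on the left as
      \<open>((\<beta> + \<gamma>, \<delta>), (\<beta>, \<gamma>))\<close> and on the right as
      \<open>((\<beta>, \<gamma> + \<delta>), (\<gamma>, \<delta>))\<close>.\<close>
    by (rule sum.reindex_bij_witness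
          [of _ "\<lambda>(p, q). ((fst p + fst q, snd q), (fst p, fst q))"
                "\<lambda>(p, q). ((fst q, snd q + snd p), (snd q, snd p))"])
       (auto simp: splits_def add.assoc mult.assoc)
  also have "\<dots> = conv qsym_coprod f (conv qsym_coprod g h) (Mbasis \<alpha>)"
    by (subst sum.Sigma[symmetric]) (auto simp: conv_Mbasis add finite_splits sum_distrib_left split_def)
  finally show "conv qsym_coprod (conv qsym_coprod f g) h (Mbasis \<alpha>) =
      conv qsym_coprod f (conv qsym_coprod g h) (Mbasis \<alpha>)" .
qed

lemma conv_qsym_unit:
  assumes "additive f"
  shows "conv qsym_coprod (\<lambda>a. of_int (qsym_counit a)) f = f"
    and "conv qsym_coprod f (\<lambda>a. of_int (qsym_counit a)) = f"
proof -
  note add = assms additive_conv additive_qsym_coprod additive_of_int[OF additive_qsym_counit]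
  show "conv qsym_coprod (\<lambda>a. of_int (qsym_counit a)) f = f"
  proof (rule additive_qsym_ext)
    fix \<alpha>
    have "conv qsym_coprod (\<lambda>a. of_int (qsym_counit a)) f (Mbasis \<alpha>) = (\<Sum>p\<in>{(0 :: composition, \<alpha>)}. f (Mbasis (snd p)))"
      unfolding conv_Mbasis[OF additive_of_int[OF additive_qsym_counit] assms] split_def
      by (rule sum.mono_neutral_cong_right)
         (auto simp: finite_splits qsym_counit_Mbasis, auto simp: splits_def split: if_splits)
    then show "conv qsym_coprod (\<lambda>a. of_int (qsym_counit a)) f (Mbasis \<alpha>) = f (Mbasis \<alpha>)" by simp
  qed (simp_all add: add)
  show "conv qsym_coprod f (\<lambda>a. of_int (qsym_counit a)) = f"
  proof (rule additive_qsym_ext)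
    fix \<alpha>
    have "conv qsym_coprod f (\<lambda>a. of_int (qsym_counit a)) (Mbasis \<alpha>) = (\<Sum>p\<in>{(\<alpha>, 0 :: composition)}. f (Mbasis (fst p)))"
      unfolding conv_Mbasis[OF assms additive_of_int[OF additive_qsym_counit]] split_def
      by (rule sum.mono_neutral_cong_right)
         (auto simp: finite_splits qsym_counit_Mbasis, auto simp: splits_def split: if_splits)
    then show "conv qsym_coprod f (\<lambda>a. of_int (qsym_counit a)) (Mbasis \<alpha>) = f (Mbasis \<alpha>)" by simp
  qed (simp_all add: add)
qed

text \<open>Since \<open>coaug\<close> kills the unit \<open>Mbasis 0\<close>, only cuts into
  \<open>n\<close> nonempty pieces could contribute, and these require degree at least
  \<open>n\<close>.\<close>

lemma coaug_pow_Mbasis: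
  assumes "sum_list (parts \<alpha>) < n"
  shows "coaug_pow qsym_coprod qsym_counit n (Mbasis \<alpha>) = 0"
  using assms
proof (induction n arbitrary: \<alpha>)
  case (Suc n)
  have "coaug_pow qsym_coprod qsym_counit n (Mbasis \<beta>) * coaug qsym_counit (Mbasis \<gamma>) = 0"
    if "(\<beta>, \<gamma>) \<in> splits \<alpha>" for \<beta> \<gamma>
  proof (cases "\<gamma> = 0")
    case True
    then show ?thesis using qsym_counit_Mbasis[of 0] by (simp add: coaug_def Mbasis_0)
  next
    case False
    then have "0 < sum_list (parts \<gamma>)" by (simp only: composition_eq_0_iff)
    then show ?thesis using Suc that sum_list_parts_add[of \<beta> \<gamma>] by (auto simp: splits_def)
  qed
  then show ?case
    by (auto simp: conv_Mbasis additive_coaug_pow additive_coaug additive_qsym_coprod additive_qsym_counit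
          intro!: sum.neutral)
qed simp

lemma conilpotent_qsym: "conilpotent_coalgebra qsym_coprod qsym_counit"
proof
  fix x y :: qsym
  show "qsym_coprod (x + y) = qsym_coprod x + qsym_coprod y" by (rule additive.add[OF additive_qsym_coprod])
  show "qsym_counit (x + y) = qsym_counit x + qsym_counit y" by (rule additive.add[OF additive_qsym_counit])
next
  fix a :: qsym
  let ?J = "coaug_pow qsym_coprod qsym_counit"
  have add: "additive (?J n)" for n by (rule additive_coaug_pow[OF additive_qsym_coprod additive_qsym_counit])
  show "\<exists>N. \<forall>n\<ge>N. ?J n a = 0"
  proof (induction a rule: qsym_diff_induct)
    case zero
    then show ?case by (simp add: additive_0[OF add])
  next
    case (Mbasis \<alpha>)
    show ?case by (intro exI[of _ "Suc (sum_list (parts \<alpha>))"]) (auto simp: coaug_pow_Mbasis)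
  next
    case (diff s t)
    then obtain M N where "\<forall>n\<ge>M. ?J n s = 0" "\<forall>n\<ge>N. ?J n t = 0" by blast
    then show ?case by (intro exI[of _ "max M N"]) (auto simp: additive_diff[OF add])
  qed
qed (simp_all only: conv_qsym_assoc conv_qsym_unit)

section \<open>Expansions in the tensor square\<close>

lemma tensor_of_int_left: "(of_int n * x) \<otimes>\<^sub>t y = x \<otimes>\<^sub>t (of_int n * y)"
  by (induction n rule: int_induct[of _ 0])
     (simp_all add: additive_0[OF additive_tensor_of(1)] additive_0[OF additive_tensor_of(2)]
        additive_diff[OF additive_tensor_of(1)] additive_diff[OF additive_tensor_of(2)]
        tensor_of_add_left tensor_of_add_right distrib_right left_diff_distrib)

text \<open>All scalars are gathered on the left factor, matching the form of
  \<open>qsym_coprod\<close>, so that coproducts and pure tensors can be compared coefficient by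
  coefficient.\<close>

lemma qsym_tensor_expand:
  assumes f: "\<And>\<alpha>. Mcoeff f \<alpha> \<noteq> 0 \<Longrightarrow> \<alpha> \<in> S" and g: "\<And>\<alpha>. Mcoeff g \<alpha> \<noteq> 0 \<Longrightarrow> \<alpha> \<in> S" and S: "finite S"
  shows "f \<otimes>\<^sub>t g = (\<Sum>(\<beta>, \<gamma>)\<in>S \<times> S. (of_int (Mcoeff f \<beta> * Mcoeff g \<gamma>) * Mbasis \<beta>) \<otimes>\<^sub>t Mbasis \<gamma>)"
proof -
  have scale: "(of_int m * x) \<otimes>\<^sub>t (of_int n * y) = (of_int (m * n) * x) \<otimes>\<^sub>t y" for m n and x y :: qsym
    using tensor_of_int_left[of m x "of_int n * y"] tensor_of_int_left[of "m * n" x y]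
    by (simp add: mult.assoc)
  have "f \<otimes>\<^sub>t g = (\<Sum>\<beta>\<in>S. of_int (Mcoeff f \<beta>) * Mbasis \<beta>) \<otimes>\<^sub>t (\<Sum>\<gamma>\<in>S. of_int (Mcoeff g \<gamma>) * Mbasis \<gamma>)"
    using qsym_expand[OF S f] qsym_expand[OF S g] by metis
  also have "\<dots> = (\<Sum>\<beta>\<in>S. \<Sum>\<gamma>\<in>S. (of_int (Mcoeff f \<beta>) * Mbasis \<beta>) \<otimes>\<^sub>t (of_int (Mcoeff g \<gamma>) * Mbasis \<gamma>))"
    unfolding additive.sum[OF additive_tensor_of(1)] by (simp only: additive.sum[OF additive_tensor_of(2)])
  finally show ?thesis by (simp only: sum.cartesian_product scale)
qed

text \<open>Indexing by the two pieces instead of their concatenation exhibits the coproduct as dual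
  to the product of NC.\<close>

lemma qsym_coprod_expand:
  assumes f: "\<And>\<alpha>. Mcoeff f \<alpha> \<noteq> 0 \<Longrightarrow> \<alpha> \<in> compositions_upto d"
  shows "qsym_coprod f = (\<Sum>(\<beta>, \<gamma>)\<in>compositions_upto d \<times> compositions_upto d.
     (of_int (Mcoeff f (\<beta> + \<gamma>)) * Mbasis \<beta>) \<otimes>\<^sub>t Mbasis \<gamma>)"
proof -
  let ?C = "compositions_upto d"
  have "qsym_coprod f = (\<Sum>(\<alpha>, \<beta>, \<gamma>)\<in>Sigma ?C splits. (of_int (Mcoeff f \<alpha>) * Mbasis \<beta>) \<otimes>\<^sub>t Mbasis \<gamma>)"
    by (subst qsym_coprod_superset[OF finite_compositions_upto f])
       (simp_all add: sum.Sigma finite_compositions_upto finite_splits)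
  also have "\<dots> = (\<Sum>(\<beta>, \<gamma>)\<in>{(\<beta>, \<gamma>). \<beta> + \<gamma> \<in> ?C}. (of_int (Mcoeff f (\<beta> + \<gamma>)) * Mbasis \<beta>) \<otimes>\<^sub>t Mbasis \<gamma>)"
    by (rule sum.reindex_bij_witness[of _ "\<lambda>(\<beta>, \<gamma>). (\<beta> + \<gamma>, \<beta>, \<gamma>)" snd]) (auto simp: splits_def)
  also have "\<dots> = (\<Sum>(\<beta>, \<gamma>)\<in>?C \<times> ?C. (of_int (Mcoeff f (\<beta> + \<gamma>)) * Mbasis \<beta>) \<otimes>\<^sub>t Mbasis \<gamma>)"
  \<comment> \<open>The square also contains pairs whose concatenation has degree above
    \<open>d\<close>; there the coefficient of \<open>f\<close> is 0.\<close>
  proof (rule sum.mono_neutral_left)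
    show "\<forall>p\<in>?C \<times> ?C - {(\<beta>, \<gamma>). \<beta> + \<gamma> \<in> ?C}.
        (case p of (\<beta>, \<gamma>) \<Rightarrow> (of_int (Mcoeff f (\<beta> + \<gamma>)) * Mbasis \<beta>) \<otimes>\<^sub>t Mbasis \<gamma>) = 0"
    proof
      fix p assume "p \<in> ?C \<times> ?C - {(\<beta>, \<gamma>). \<beta> + \<gamma> \<in> ?C}"
      then have "fst p + snd p \<notin> ?C" by auto
      then have "Mcoeff f (fst p + snd p) = 0" using f by blast
      then show "(case p of (\<beta>, \<gamma>) \<Rightarrow> (of_int (Mcoeff f (\<beta> + \<gamma>)) * Mbasis \<beta>) \<otimes>\<^sub>t Mbasis \<gamma>) = 0"
        by (simp add: additive_0[OF additive_tensor_of(1)] split_def)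
    qed
  qed (auto simp: finite_compositions_upto, auto simp: compositions_upto_def sum_list_parts_add)
  finally show ?thesis .
qed


section \<open>Multiplicativity and comultiplicativity of K\<close>

text \<open>Decompositions of a list may have zero entries; deleting them reflects that the
  generator of index 0 is 1 in NC, and that zero exponents do not show in a monomial.\<close>

definition strip :: "nat list \<Rightarrow> composition" where
  "strip l = composition (filter (\<lambda>k. k \<noteq> 0) l)"

lemma strip_Nil [simp]: "strip [] = 0"
  by (simp add: strip_def zero_composition_def)

lemma parts_strip: "parts (strip l) = filter (\<lambda>k. k \<noteq> 0) l"
  by (simp add: strip_def composition_inverse)

lemma strip_append: "strip (l @ l') = strip l + strip l'"
  by (simp add: parts_inject[symmetric] parts_strip plus_composition.rep_eq)

lemma strip_Cons: "strip (k # l) = h_index k + strip l"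
  by (simp add: parts_inject[symmetric] parts_strip plus_composition.rep_eq h_index_def
      zero_composition.rep_eq composition_inverse)

lemma list_decomps_Nil [simp]: "list_decomps [] = {([], [])}"
  by (auto simp: list_decomps_def)

lemma sum_list_decomps_Cons:
  "(\<Sum>(as, bs)\<in>list_decomps (k # l). G as bs) =
     (\<Sum>i\<le>k. \<Sum>(as, bs)\<in>list_decomps l. G (i # as) ((k - i) # bs))"
proof -
  have "(\<Sum>(as, bs)\<in>list_decomps (k # l). G as bs) =
      (\<Sum>(i, as, bs)\<in>{..k} \<times> list_decomps l. G (i # as) ((k - i) # bs))"
    by (rule sum.reindex_bij_witness
          [of _ "\<lambda>(i, as, bs). (i # as, (k - i) # bs)" "\<lambda>(as, bs). (hd as, tl as, tl bs)"])
       (force simp: list_decomps_def length_Suc_conv All_less_Suc2)+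
  then show ?thesis by (simp add: sum.cartesian_product)
qed

lemma sum_list_decomps_append:
  "(\<Sum>(as, bs)\<in>list_decomps (l @ l'). G as bs) =
     (\<Sum>(as, bs)\<in>list_decomps l. \<Sum>(as', bs')\<in>list_decomps l'. G (as @ as') (bs @ bs'))"
  by (induction l arbitrary: G) (simp_all add: sum_list_decomps_Cons)

text \<open>Multiplying out the coproducts of the generators chooses, for each part, how much of it
  goes to the left factor. Equal stripped pairs are kept as separate summands.\<close>

lemma nc_coprod_frag_of:
  "nc_coprod (frag_of \<alpha>) = (\<Sum>(as, bs)\<in>list_decomps (parts \<alpha>). frag_of (strip as, strip bs))"
proof -
  have "prod_list (map nc_coprod_gen l) = (\<Sum>(as, bs)\<in>list_decomps l. frag_of (strip as, strip bs))" for l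
  proof (induction l)
    case Nil
    show ?case by (simp flip: zero_prod_def)
  next
    case (Cons k l)
    have "prod_list (map nc_coprod_gen (k # l)) =
        (\<Sum>i\<le>k. \<Sum>(as, bs)\<in>list_decomps l. frag_of (h_index i, h_index (k - i)) * frag_of (strip as, strip bs))"
      by (simp add: Cons nc_coprod_gen_def sum_distrib_left sum_distrib_right split_def)
        (rule sum.swap)
    then show ?case unfolding sum_list_decomps_Cons by (simp add: mult_single strip_Cons split_def)
  qed
  then show ?thesis by (simp add: nc_coprod_def)
qed

lemma mcoeff_eq_Mcoeff: "mcoeff f m = Mcoeff f (composition (exponents m))"
proof -
  have "exponents (Poly_Mapping.nth (parts (composition (exponents m)))) = exponents m"
    by (simp add: composition_inverse zero_notin_exponents exponents_nth)
  moreover have "quasi_symmetric (mcoeff f)" using mcoeff by auto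
  ultimately show ?thesis unfolding quasi_symmetric_def Mcoeff_def by metis
qed

text \<open>Splitting an exponent vector into two gives the same index set as in
  \<open>nc_coprod_frag_of\<close>; together they say that the product of QSym is dual to the
  coproduct of NC.\<close>

lemma Mcoeff_mult:
  "Mcoeff (f * g) \<alpha> = (\<Sum>(as, bs)\<in>list_decomps (parts \<alpha>). Mcoeff f (strip as) * Mcoeff g (strip bs))"
proof -
  define m :: "nat \<Rightarrow>\<^sub>0 nat" where "m = Poly_Mapping.nth (parts \<alpha>)"
  let ?ks = "sorted_list_of_set (Poly_Mapping.keys m)"
  have \<alpha>: "exponents m = parts \<alpha>" using parts[of \<alpha>] by (simp add: m_def exponents_nth)
  have "Mcoeff (f * g) \<alpha> = (\<Sum>(a, b)\<in>decomps m. mcoeff f a * mcoeff g b)"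
    by (simp add: Mcoeff_def times_qsym.rep_eq ps_mult_def m_def)
  also have "\<dots> = (\<Sum>(a, b)\<in>decomps m. Mcoeff f (strip (map (Poly_Mapping.lookup a) ?ks)) *
      Mcoeff g (strip (map (Poly_Mapping.lookup b) ?ks)))"
  proof (rule sum.cong[OF refl], clarify)
    fix a b assume "(a, b) \<in> decomps m"
    then have "Poly_Mapping.keys a \<subseteq> Poly_Mapping.keys m" "Poly_Mapping.keys b \<subseteq> Poly_Mapping.keys m"
      by (auto simp: decomps_def in_keys_iff lookup_add)
    then show "mcoeff f a * mcoeff g b = Mcoeff f (strip (map (Poly_Mapping.lookup a) ?ks)) *
        Mcoeff g (strip (map (Poly_Mapping.lookup b) ?ks))"
      by (simp add: mcoeff_eq_Mcoeff exponents_eq_filter strip_def)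
  qed
  also have "\<dots> = (\<Sum>(as, bs)\<in>list_decomps (parts \<alpha>). Mcoeff f (strip as) * Mcoeff g (strip bs))"
    unfolding \<alpha>[symmetric] sum.reindex_bij_betw[OF bij_betw_decomps, symmetric]
    by (simp add: split_def)
  finally show ?thesis .
qed

text \<open>Multiplicities in the coproduct are counted by repeated decompositions instead of
  coefficients, which brings the sum into the shape of \<open>Mcoeff_mult\<close>.\<close>

lemma lookup_zpow_act_Cons_strip:
  "Poly_Mapping.lookup (zpow_act hbar (x # xs) (frag_of \<alpha>)) (y # ys) =
     (\<Sum>(as, bs)\<in>list_decomps (parts \<alpha>).
        Poly_Mapping.lookup (zp_act hbar (frag_of x) (frag_of (strip as))) y *
        Poly_Mapping.lookup (zpow_act hbar xs (frag_of (strip bs))) ys)"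
proof -
  have add: "additive (frag_extend F)" for F :: "'x \<Rightarrow> 'y \<Rightarrow>\<^sub>0 int"
    by (simp add: additive_def frag_extend_add)
  show ?thesis
    by (simp add: nc_coprod_frag_of split_def additive.sum[OF add] lookup_sum lookup_zp_cons)
qed

section \<open>Composing actions through intermediate elements\<close>

lemma additive_fold_pieri:
  assumes "pieri_operators hbar" "0 \<notin> set ks"
  shows "additive (fold hbar ks)"
  using assms(2)
proof (induction ks)
  case (Cons k ks)
  then have "additive (hbar k)" using assms(1) unfolding pieri_operators_def by auto
  moreover have "additive (fold hbar ks)" using Cons by simp
  ultimately have "additive (\<lambda>v. fold hbar ks (hbar k v))" by (rule additive_compose[rotated])
  then show ?case by (simp add: o_def)
qed (simp add: additive_def)

lemma lookup_additive:
  assumes "additive \<phi>"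
  shows "Poly_Mapping.lookup (\<phi> u) y =
    (\<Sum>z\<in>Poly_Mapping.keys u. Poly_Mapping.lookup u z * Poly_Mapping.lookup (\<phi> (frag_of z)) y)"
proof -
  have "\<phi> u = frag_extend (\<lambda>z. \<phi> (frag_of z)) u"
    by (rule additive_free_ext[OF assms]) (simp_all add: additive_def frag_extend_add)
  then show ?thesis by (simp add: lookup_frag_extend)
qed

text \<open>Successive actions multiply as matrices indexed by P. Pieri operators only move upwards,
  so the intermediate element may be confined to the interval from \<open>x\<close> to
  \<open>y\<close>.\<close>

lemma lookup_zp_act_add:
  fixes x y :: "'p::graded_poset"
  assumes "pieri_operators hbar"
  shows "Poly_Mapping.lookup (zp_act hbar (frag_of x) (frag_of (\<beta> + \<gamma>))) y =
    (\<Sum>z | x \<le> z \<and> z \<le> y. Poly_Mapping.lookup (zp_act hbar (frag_of x) (frag_of \<beta>)) z *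
       Poly_Mapping.lookup (zp_act hbar (frag_of z) (frag_of \<gamma>)) y)"
proof -
  let ?u = "zp_act hbar (frag_of x) (frag_of \<beta>)"
  have add: "additive (fold hbar (parts \<gamma>))"
    using additive_fold_pieri[OF assms] parts[of \<gamma>] by simp
  have "zp_act hbar (frag_of x) (frag_of (\<beta> + \<gamma>)) = fold hbar (parts \<gamma>) ?u"
    by (simp add: zp_act_def plus_composition.rep_eq)
  then have "Poly_Mapping.lookup (zp_act hbar (frag_of x) (frag_of (\<beta> + \<gamma>))) y =
      (\<Sum>z\<in>Poly_Mapping.keys ?u. Poly_Mapping.lookup ?u z *
         Poly_Mapping.lookup (zp_act hbar (frag_of z) (frag_of \<gamma>)) y)"
    using lookup_additive[OF add, of ?u y] by (simp add: zp_act_def)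
  also have "\<dots> = (\<Sum>z | x \<le> z \<and> z \<le> y. Poly_Mapping.lookup ?u z *
         Poly_Mapping.lookup (zp_act hbar (frag_of z) (frag_of \<gamma>)) y)"
  proof (rule sum.mono_neutral_cong)
    have "x \<le> z" if "z \<in> Poly_Mapping.keys ?u" for z using zp_act_degree[OF assms that] by simp
    moreover have "z \<le> y" if "Poly_Mapping.lookup (zp_act hbar (frag_of z) (frag_of \<gamma>)) y \<noteq> 0" for z
      using zp_act_degree[OF assms, of y z \<gamma>] that by (simp add: in_keys_iff)
    ultimately show "Poly_Mapping.lookup ?u z * Poly_Mapping.lookup (zp_act hbar (frag_of z) (frag_of \<gamma>)) y = 0"
      if "z \<in> Poly_Mapping.keys ?u - {z. x \<le> z \<and> z \<le> y}" for z using that by auto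
  qed (auto simp: finite_interval in_keys_iff)
  finally show ?thesis .
qed

lemma sum_elements_Cons:
  "(\<Sum>zs\<in>elements (Intervals ((x, y) # l)). G zs) =
     (\<Sum>z | x \<le> z \<and> z \<le> y. \<Sum>zs\<in>elements (Intervals l). G (z # zs))"
proof -
  let ?I = "{z. x \<le> z \<and> z \<le> y}"
  have "elements (Intervals ((x, y) # l)) = (\<lambda>(z, zs). z # zs) ` (?I \<times> elements (Intervals l))"
    by (auto simp: elements_def list_all2_Cons1)
  moreover have "inj_on (\<lambda>(z, zs). z # zs) (?I \<times> elements (Intervals l))"
    by (auto intro!: inj_onI)
  ultimately have "(\<Sum>zs\<in>elements (Intervals ((x, y) # l)). G zs) =
      (\<Sum>(z, zs)\<in>?I \<times> elements (Intervals l). G (z # zs))"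
    by (simp add: sum.reindex split_def)
  then show ?thesis by (simp only: sum.cartesian_product)
qed

lemma sum_rotate3:
  "(\<Sum>q\<in>A. \<Sum>r\<in>B. \<Sum>z\<in>C. G q r z) = (\<Sum>z\<in>C. \<Sum>q\<in>A. \<Sum>r\<in>B. G q r z)"
proof -
  have "(\<Sum>q\<in>A. \<Sum>r\<in>B. \<Sum>z\<in>C. G q r z) = (\<Sum>q\<in>A. \<Sum>z\<in>C. \<Sum>r\<in>B. G q r z)"
    by (intro sum.cong refl sum.swap)
  also have "\<dots> = (\<Sum>z\<in>C. \<Sum>q\<in>A. \<Sum>r\<in>B. G q r z)" by (rule sum.swap)
  finally show ?thesis .
qed

text \<open>In its use for the module law, the left side groups matrix entries by coordinate (first
  coordinate against the rest), the right side by which of the two compositions acts.\<close>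

lemma sum_product_exchange:
  fixes a :: "_ \<Rightarrow> _ \<Rightarrow> 'b::comm_semiring_0"
  shows "(\<Sum>q\<in>A. \<Sum>r\<in>B. (\<Sum>z\<in>C. a q z * c z r) * (\<Sum>w\<in>D. b q w * d w r)) =
    (\<Sum>z\<in>C. \<Sum>w\<in>D. (\<Sum>q\<in>A. a q z * b q w) * (\<Sum>r\<in>B. c z r * d w r))"
proof -
  have "(\<Sum>q\<in>A. \<Sum>r\<in>B. (\<Sum>z\<in>C. a q z * c z r) * (\<Sum>w\<in>D. b q w * d w r)) =
      (\<Sum>q\<in>A. \<Sum>r\<in>B. \<Sum>z\<in>C. \<Sum>w\<in>D. (a q z * b q w) * (c z r * d w r))"
    by (simp only: sum_product mult_ac)
  also have "\<dots> = (\<Sum>z\<in>C. \<Sum>q\<in>A. \<Sum>r\<in>B. \<Sum>w\<in>D. (a q z * b q w) * (c z r * d w r))"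
    by (rule sum_rotate3)
  also have "\<dots> = (\<Sum>z\<in>C. \<Sum>w\<in>D. \<Sum>q\<in>A. \<Sum>r\<in>B. (a q z * b q w) * (c z r * d w r))"
    by (intro sum.cong refl sum_rotate3)
  finally show ?thesis by (simp only: sum_product)
qed

text \<open>The module law \<open>v.(S\<^sup>\<beta> S\<^sup>\<gamma>) = (v.S\<^sup>\<beta>).S\<^sup>\<gamma>\<close> in \<open>\<int>(P\<^sup>k)\<close>, in terms of matrix entries.\<close>

lemma lookup_zpow_act_add:
  fixes l :: "('p::graded_poset \<times> 'p) list"
  assumes "pieri_operators hbar"
  shows "Poly_Mapping.lookup (zpow_act hbar (map fst l) (frag_of (\<beta> + \<gamma>))) (map snd l) =
    (\<Sum>zs\<in>elements (Intervals l). Poly_Mapping.lookup (zpow_act hbar (map fst l) (frag_of \<beta>)) zs *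
       Poly_Mapping.lookup (zpow_act hbar zs (frag_of \<gamma>)) (map snd l))"
proof (induction l arbitrary: \<beta> \<gamma>)
  case Nil
  then show ?case
    by (auto simp: elements_def nc_counit_def composition_add_eq_0_iff)
next
  case (Cons q l)
  obtain x y where q: "q = (x, y)" by (cases q)
  let ?p = "\<lambda>x \<beta> y. Poly_Mapping.lookup (zp_act hbar (frag_of x) (frag_of \<beta>)) y"
  let ?P = "\<lambda>xs \<beta> ys. Poly_Mapping.lookup (zpow_act hbar xs (frag_of \<beta>)) ys"
  let ?I = "{z. x \<le> z \<and> z \<le> y}" and ?E = "elements (Intervals l)"
  let ?L = "list_decomps (parts \<beta>)" and ?L' = "list_decomps (parts \<gamma>)"
  \<comment> \<open>A decomposition of the concatenated parts is a pair of decompositions, one of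
    \<beta> and one of \<gamma>; this is multiplicativity of the coproduct of NC.\<close>
  have "?P (map fst (q # l)) (\<beta> + \<gamma>) (map snd (q # l)) =
      (\<Sum>(as, bs)\<in>?L. \<Sum>(as', bs')\<in>?L'. ?p x (strip as + strip as') y *
         ?P (map fst l) (strip bs + strip bs') (map snd l))"
    by (simp add: q lookup_zpow_act_Cons_strip plus_composition.rep_eq sum_list_decomps_append strip_append
        del: zpow_act.simps)
  also have "\<dots> = (\<Sum>p\<in>?L. \<Sum>p'\<in>?L'.
      (\<Sum>z\<in>?I. ?p x (strip (fst p)) z * ?p z (strip (fst p')) y) *
      (\<Sum>zs\<in>?E. ?P (map fst l) (strip (snd p)) zs * ?P zs (strip (snd p')) (map snd l)))"
    by (simp only: split_def lookup_zp_act_add[OF assms] Cons.IH)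
  also have "\<dots> = (\<Sum>z\<in>?I. \<Sum>zs\<in>?E.
      (\<Sum>p\<in>?L. ?p x (strip (fst p)) z * ?P (map fst l) (strip (snd p)) zs) *
      (\<Sum>p'\<in>?L'. ?p z (strip (fst p')) y * ?P zs (strip (snd p')) (map snd l)))"
    by (rule sum_product_exchange)
  also have "\<dots> = (\<Sum>z\<in>?I. \<Sum>zs\<in>?E. ?P (x # map fst l) \<beta> (z # zs) * ?P (z # zs) \<gamma> (y # map snd l))"
    by (simp only: lookup_zpow_act_Cons_strip split_def)
  also have "\<dots> = (\<Sum>zs\<in>elements (Intervals (q # l)). ?P (map fst (q # l)) \<beta> zs * ?P zs \<gamma> (map snd (q # l)))"
    by (simp add: q sum_elements_Cons del: zpow_act.simps)
  finally show ?case .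
qed

section \<open>Values of K on products of intervals\<close>

lemma Mcoeff_K_basis:
  assumes "pieri_operators hbar"
  shows "Mcoeff (K_basis hbar A) \<alpha> = Poly_Mapping.lookup (zpow_act hbar (lower A) (frag_of \<alpha>)) (upper A)"
  using qsym_pairing_K_basis[OF assms, of A "frag_of \<alpha>"] by simp

lemma K_basis_0:
  assumes "pieri_operators hbar"
  shows "K_basis hbar 0 = 1"
proof (rule qsym_eqI)
  show "Mcoeff (K_basis hbar 0) \<alpha> = Mcoeff 1 \<alpha>" for \<alpha>
    by (simp add: Mcoeff_K_basis[OF assms] lower_def upper_def zero_intervals_def nc_counit_def
        Mcoeff_Mbasis flip: Mbasis_0)
qed

text \<open>A bound on the degree makes the combination of monomial functions with coefficients
  \<open>F\<close> finite.\<close>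

lemma qsym_of_coeffs:
  assumes "\<And>\<alpha>. F \<alpha> \<noteq> 0 \<Longrightarrow> sum_list (parts \<alpha>) \<le> d"
  shows "\<exists>f. \<forall>\<alpha>. Mcoeff f \<alpha> = F \<alpha>"
proof -
  have "F \<alpha> \<noteq> 0 \<Longrightarrow> \<alpha> \<in> compositions_upto d" for \<alpha>
    using assms by (simp add: compositions_upto_def)
  then have "Mcoeff (\<Sum>\<beta>\<in>compositions_upto d. of_int (F \<beta>) * Mbasis \<beta>) \<alpha> = F \<alpha>" for \<alpha>
    by (auto simp: additive.sum[OF additive_Mcoeff] Mcoeff_of_int_mult Mcoeff_Mbasis finite_compositions_upto
        if_distrib cong: if_cong)
  then show ?thesis by blast
qed

text \<open>
  Splitting off one factor at a time lets associativity of the product of \<open>QSym\<close> take the place of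
  coassociativity of \<open>NC\<close> in the proof that \<open>K\<close> is multiplicative.
\<close>

lemma K_basis_Cons:
  fixes x y :: "'p::graded_poset"
  assumes "pieri_operators hbar"
  shows "\<exists>Q. \<forall>l. K_basis hbar (Intervals ((x, y) # l)) = Q * K_basis hbar (Intervals l)"
proof -
  let ?p = "\<lambda>\<beta>. Poly_Mapping.lookup (zp_act hbar (frag_of x) (frag_of \<beta>)) y"
  have "sum_list (parts \<beta>) \<le> rk y" if "?p \<beta> \<noteq> 0" for \<beta>
    using zp_act_degree[OF assms, of y x \<beta>] that by (simp add: in_keys_iff)
  \<comment> \<open>\<open>Q\<close> is K of the single interval from \<open>x\<close> to
    \<open>y\<close>, built directly from the action on ZP.\<close>
  then obtain Q where Q: "\<And>\<beta>. Mcoeff Q \<beta> = ?p \<beta>" using qsym_of_coeffs[of ?p] by blast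
  have "K_basis hbar (Intervals ((x, y) # l)) = Q * K_basis hbar (Intervals l)" for l
    by (rule qsym_eqI)
       (simp add: Mcoeff_mult Mcoeff_K_basis[OF assms] Q lower_def upper_def lookup_zpow_act_Cons_strip
         del: zpow_act.simps)
  then show ?thesis by blast
qed

lemma K_basis_add:
  fixes A B :: "'p::graded_poset intervals"
  assumes "pieri_operators hbar"
  shows "K_basis hbar (A + B) = K_basis hbar A * K_basis hbar B"
proof -
  have "K_basis hbar (Intervals (l @ l')) = K_basis hbar (Intervals l) * K_basis hbar (Intervals l')"
    for l l' :: "('p \<times> 'p) list"
  proof (induction l)
    case Nil
    then show ?case using K_basis_0[OF assms] by (simp add: zero_intervals_def)
  next
    case (Cons q l)
    \<comment> \<open>One \<open>Q\<close> serves all tails, so it factors out for both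
      \<open>l\<close> and \<open>l @ l'\<close>.\<close>
    obtain Q where "\<And>l. K_basis hbar (Intervals (q # l)) = Q * K_basis hbar (Intervals l)"
      using K_basis_Cons[OF assms] by (cases q) blast
    then show ?case by (simp add: Cons mult.assoc)
  qed
  from this[of "factors A" "factors B"] show ?thesis by (simp add: plus_intervals_def)
qed

lemma zpow_act_1: "zpow_act hbar xs (frag_of 0) = frag_of xs"
proof (induction xs)
  case (Cons x xs)
  have "nc_coprod (frag_of 0) = frag_of (0, 0)"
    by (simp only: nc_coprod_frag_of) (simp add: zero_composition.rep_eq)
  moreover have "zp_act hbar (frag_of x) (frag_of 0) = frag_of x"
    by (simp add: zp_act_def zero_composition.rep_eq del: single_one)
  ultimately show ?case using Cons by (simp add: zp_cons_def del: single_one)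
qed (simp add: nc_counit_def)

text \<open>The empty composition acts as the identity, so the constant coefficient is the delta
  function of the end points, as is the counit of HP on nonempty intervals.\<close>

lemma qsym_counit_K_basis:
  fixes A :: "'p::graded_poset intervals"
  assumes "pieri_operators hbar"
  shows "qsym_counit (K_basis hbar A) = hp_counit (hp_of A)"
proof (cases "list_all2 (\<le>) (lower A) (upper A)")
  case True
  then show ?thesis
    using counit_interval[OF True]
    by (simp add: qsym_counit_def Mcoeff_K_basis[OF assms] zpow_act_1 interval_lower_upper del: single_one)
next
  case False
  then have "lower A \<noteq> upper A" using list_all2_le_refl by metis
  then show ?thesis
    using hp_of_not_le[OF False]
    by (simp add: qsym_counit_def Mcoeff_K_basis[OF assms] zpow_act_1 additive_0[OF hp_counit_of(1)] del: single_one)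
qed

text \<open>Both sides are expanded over the same finite square of compositions; equality of the
  coefficients at (\<beta>, \<gamma>) is the module law \<open>lookup_zpow_act_add\<close>.\<close>

lemma qsym_coprod_K_basis:
  fixes A :: "'p::graded_poset intervals"
  assumes "pieri_operators hbar"
  shows "qsym_coprod (K_basis hbar A) =
    (\<Sum>zs\<in>elements A. K_basis hbar (interval (lower A) zs) \<otimes>\<^sub>t K_basis hbar (interval zs (upper A)))"
proof -
  \<comment> \<open>The total rank of the upper end bounds the degree of K on \<open>A\<close> and,
    by monotonicity of rank, on every lower and upper piece of \<open>A\<close>.\<close>
  define d where "d = sum_list (map rk (upper A))"
  let ?C = "compositions_upto d"
  have deg: "\<alpha> \<in> ?C" if "Mcoeff (K_basis hbar B) \<alpha> \<noteq> 0" "sum_list (map rk (upper B)) \<le> d"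
    for \<alpha> and B :: "'p intervals"
    using zpow_act_degree[OF assms that(1)[unfolded Mcoeff_K_basis[OF assms]]] that(2)
    by (simp add: compositions_upto_def)
  have tens: "K_basis hbar (interval (lower A) zs) \<otimes>\<^sub>t K_basis hbar (interval zs (upper A)) =
      (\<Sum>(\<beta>, \<gamma>)\<in>?C \<times> ?C. (of_int (Poly_Mapping.lookup (zpow_act hbar (lower A) (frag_of \<beta>)) zs *
         Poly_Mapping.lookup (zpow_act hbar zs (frag_of \<gamma>)) (upper A)) * Mbasis \<beta>) \<otimes>\<^sub>t Mbasis \<gamma>)"
    if zs: "zs \<in> elements A" for zs
  proof -
    have len: "length (lower A) = length zs" "length zs = length (upper A)"
      and le: "list_all2 (\<le>) zs (upper A)"
      using zs by (auto simp: elements_iff dest: list_all2_lengthD)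
    have "upper (interval (lower A) zs) = zs" "upper (interval zs (upper A)) = upper A"
      "lower (interval (lower A) zs) = lower A" "lower (interval zs (upper A)) = zs"
      by (simp_all add: len upper_interval lower_interval)
    note bounds = this
    have "K_basis hbar (interval (lower A) zs) \<otimes>\<^sub>t K_basis hbar (interval zs (upper A)) =
        (\<Sum>(\<beta>, \<gamma>)\<in>?C \<times> ?C. (of_int (Mcoeff (K_basis hbar (interval (lower A) zs)) \<beta> *
           Mcoeff (K_basis hbar (interval zs (upper A))) \<gamma>) * Mbasis \<beta>) \<otimes>\<^sub>t Mbasis \<gamma>)"
    proof (rule qsym_tensor_expand)
      show "\<alpha> \<in> ?C" if "Mcoeff (K_basis hbar (interval (lower A) zs)) \<alpha> \<noteq> 0" for \<alpha>
        using deg[OF that] sum_list_rk_mono[OF le] by (simp add: bounds d_def)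
      show "\<alpha> \<in> ?C" if "Mcoeff (K_basis hbar (interval zs (upper A))) \<alpha> \<noteq> 0" for \<alpha>
        using deg[OF that] by (simp add: bounds d_def)
    qed (rule finite_compositions_upto)
    then show ?thesis by (simp only: Mcoeff_K_basis[OF assms] bounds)
  qed
  have "qsym_coprod (K_basis hbar A) = (\<Sum>(\<beta>, \<gamma>)\<in>?C \<times> ?C.
      (of_int (Mcoeff (K_basis hbar A) (\<beta> + \<gamma>)) * Mbasis \<beta>) \<otimes>\<^sub>t Mbasis \<gamma>)"
    by (rule qsym_coprod_expand) (rule deg, assumption, simp only: d_def)
  also have "\<dots> = (\<Sum>(\<beta>, \<gamma>)\<in>?C \<times> ?C. \<Sum>zs\<in>elements A.
      (of_int (Poly_Mapping.lookup (zpow_act hbar (lower A) (frag_of \<beta>)) zs *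
         Poly_Mapping.lookup (zpow_act hbar zs (frag_of \<gamma>)) (upper A)) * Mbasis \<beta>) \<otimes>\<^sub>t Mbasis \<gamma>)"
    using lookup_zpow_act_add[OF assms, of "factors A"]
    by (simp add: Mcoeff_K_basis[OF assms] flip: lower_def upper_def)
       (simp only: of_int_sum sum_distrib_right additive.sum[OF additive_tensor_of(1)])
  also have "\<dots> = (\<Sum>zs\<in>elements A. K_basis hbar (interval (lower A) zs) \<otimes>\<^sub>t K_basis hbar (interval zs (upper A)))"
    by (simp add: tens split_def sum.swap[of _ "elements A"])
  finally show ?thesis .
qed

theorem theorem2p2:
  fixes hbar :: "nat \<Rightarrow> ('p::graded_poset \<Rightarrow>\<^sub>0 int) \<Rightarrow> ('p \<Rightarrow>\<^sub>0 int)"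
  assumes "pieri_operators hbar"
  shows "hopf_morphism hp_coprod hp_counit qsym_coprod qsym_counit (K_map hbar)"
\<comment> \<open>What remains are the bialgebra identities; additivity reduces them to products of
  intervals.\<close>
proof (rule conilpotent_hopf_morphismI[OF conilpotent_hp conilpotent_qsym])
  note K = K_map_of[OF assms]
  show "additive (K_map hbar)" by (rule K)
  show "K_map hbar 1 = 1" by (simp add: K K_basis_0[OF assms] flip: hp_of_0)
  show "K_map hbar (a * b) = K_map hbar a * K_map hbar b" for a b
  proof (induction a rule: hp_diff_induct)
    case (of A)
    show ?case
      by (induction b rule: hp_diff_induct)
         (simp_all add: K(2) K_basis_add[OF assms] additive_0[OF K(1)] additive_diff[OF K(1)] right_diff_distrib
           flip: hp_of_add)
  qed (simp_all add: additive_0[OF K(1)] additive_diff[OF K(1)] left_diff_distrib)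
  show "qsym_counit (K_map hbar a) = hp_counit a" for a
  proof (induction a rule: hp_diff_induct)
  qed (simp_all add: K(2) qsym_counit_K_basis[OF assms] additive_0[OF K(1)] additive_diff[OF K(1)]
      additive_0[OF hp_counit_of(1)] additive_diff[OF hp_counit_of(1)]
      additive_0[OF additive_qsym_counit] additive_diff[OF additive_qsym_counit])
  note T = additive_tensor_map[OF K(1) K(1)]
  show "qsym_coprod (K_map hbar a) = tensor_map (K_map hbar) (K_map hbar) (hp_coprod a)" for a
  proof (induction a rule: hp_diff_induct)
    case (of A)
    show ?case
      by (simp add: K(2) qsym_coprod_K_basis[OF assms] hp_coprod_of(2) additive.sum[OF T] tensor_map_of[OF K(1) K(1)])
  qed (simp_all add: additive_0[OF K(1)] additive_diff[OF K(1)] additive_0[OF T] additive_diff[OF T]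
      additive_0[OF hp_coprod_of(1)] additive_diff[OF hp_coprod_of(1)]
      additive_0[OF additive_qsym_coprod] additive_diff[OF additive_qsym_coprod])
qed

end
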